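(* Let $\tau$ lie in the upper half-plane and let $s,t,u,v$ be complex numbers such that $s+t+u+v$ is an integral multiple of $\pi$ and $\theta_4(s|\tau)\theta_4(t|\tau)\theta_4(u|\tau)\theta_4(v|\tau)\neq0$. Then \[ (\log \theta_4)'(s|\tau)+(\log \theta_4)'(t|\tau)+(\log \theta_4)'(u|\tau)+(\log \theta_4)'(v|\tau) =-\frac{\vartheta_1'(\tau)\theta_1(s+t|\tau)\theta_1(s+u|\tau)\theta_1(s+v|\tau)}{\theta_4(s|\tau)\theta_4(t|\tau)\theta_4(u|\tau)\theta_4(v|\tau)}, \] or equivalently \[ 4\sum_{n=1}^\infty \frac{q^{n/2}}{1-q^n} \left(\sin 2n s + \sin 2nt +\sin 2n u+\sin 2nv\right) =-\frac{\vartheta_1'(\tau)\theta_1(s+t|\tau)\theta_1(s+u|\tau)\theta_1(s+v|\tau)}{\theta_4(s|\tau)\theta_4(t|\tau)\theta_4(u|\tau)\theta_4(v|\tau)}. \]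
   Context: $q=e^{2\pi i\tau}$, $q^a=e^{2\pi i a\tau}$; $\theta_1(z|\tau)=2\sum_{n\ge0}(-1)^nq^{(2n+1)^2/8}\sin(2n+1)z$, $\theta_4(z|\tau)=1+2\sum_{n\ge1}(-1)^nq^{n^2/2}\cos 2nz$; $\vartheta_1'(\tau)$ is the $z$-derivative of $\theta_1(z|\tau)$ at $z=0$; $(\log\theta_4)'$ is the logarithmic derivative in the first variable.
   Formalization: With s+t+u+v = kπ, the right-hand sides carry an extra factor (−1)^k, since the printed sign is wrong for odd k; the second formula is asserted whenever its series converges, and convergence is proved when 2|Im z| < π Im τ for z = s,t,u,v. *)

theory Defs
  imports "HOL-Complex_Analysis.Complex_Analysis"
begin

text \<open>With \<open>q = exp (2 \<pi> i \<tau>)\<close>, fractional powers of \<open>q\<close> are determined by \<open>\<tau>\<close> and not by a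
  branch of the logarithm of \<open>q\<close>.\<close>

definition qpow :: "complex \<Rightarrow> real \<Rightarrow> complex" where
  "qpow \<tau> a = exp (2 * of_real pi * \<i> * of_real a * \<tau>)"

definition theta1 :: "complex \<Rightarrow> complex \<Rightarrow> complex" where
  "theta1 z \<tau> = 2 * (\<Sum>n. (- 1) ^ n * qpow \<tau> ((2 * real n + 1)\<^sup>2 / 8) * sin ((2 * of_nat n + 1) * z))"

definition theta4 :: "complex \<Rightarrow> complex \<Rightarrow> complex" where
  "theta4 z \<tau> =
     1 + 2 * (\<Sum>n. (- 1) ^ Suc n * qpow \<tau> ((real (Suc n))\<^sup>2 / 2) * cos (2 * of_nat (Suc n) * z))"

definition vartheta1' :: "complex \<Rightarrow> complex" where
  "vartheta1' \<tau> = deriv (\<lambda>z. theta1 z \<tau>) 0"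

definition log_theta4' :: "complex \<Rightarrow> complex \<Rightarrow> complex" where
  "log_theta4' z \<tau> = deriv (\<lambda>w. theta4 w \<tau>) z / theta4 z \<tau>"

definition lambert_term :: "complex \<Rightarrow> complex \<Rightarrow> complex \<Rightarrow> complex \<Rightarrow> complex \<Rightarrow> nat \<Rightarrow> complex" where
  "lambert_term \<tau> s t u v n =
     qpow \<tau> (real n / 2) / (1 - qpow \<tau> (real n)) *
     (sin (2 * of_nat n * s) + sin (2 * of_nat n * t) + sin (2 * of_nat n * u) + sin (2 * of_nat n * v))"

end

theory Submission
  imports Defs
begin

text \<open>
  Let \<open>A(z) = \<theta>\<^sub>3(z|2\<tau>)\<close> and \<open>B(z) = \<theta>\<^sub>2(z|2\<tau>)\<close>. Substituting \<open>(m, n) = (j + l, j - l)\<close> in the double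
  series of the left-hand sides gives
  \<open>\<theta>\<^sub>4(x) \<theta>\<^sub>4(y) = A(x+y) A(x-y) - B(x+y) B(x-y)\<close> and
  \<open>\<theta>\<^sub>1(x) \<theta>\<^sub>1(y) = A(x+y) B(x-y) - B(x+y) A(x-y)\<close>.
  After clearing denominators, and for \<open>s + t + u + v = 0\<close>, both sides of the first formula are
  \<open>2 (A B' - A' B)(s+t) (A(s-t) B(u-v) - B(s-t) A(u-v))\<close>; a shift of \<open>v\<close> by \<open>k \<pi>\<close> gives the general case.

  In the strip \<open>2 |Im z| < \<pi> Im \<tau>\<close> the Lambert series of \<open>\<theta>\<^sub>4'/\<theta>\<^sub>4\<close> is obtained by multiplying it with
  \<open>\<theta>\<^sub>4\<close>: comparing Fourier coefficients, the claim becomes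
  \<open>\<Sum>\<^bsub>k\<noteq>0\<^esub> (-1)\<^sup>k p\<^bsup>k\<^sup>2-2nk\<^esup> / (p\<^bsup>-k\<^esup> - p\<^bsup>k\<^esup>) = -n\<close> with \<open>p = q\<^bsup>1/2\<^esup>\<close>.

  If the series converges, its terms tend to 0, and so does a combination of the powers
  \<open>(p e\<^bsup>\<plusminus>2iz\<^esup>)\<^sup>n\<close>, \<open>z = s, t, u, v\<close>. Hence either all four points lie in the strip, or two exponentials
  cancel; then the sum of two of the points is in \<open>\<pi> \<int>\<close> and both sides vanish.
\<close>

section \<open>Sums over the integers and Fourier series with Gaussian decay\<close>

(* Otherwise the infix is ambiguous between Infinite_Sum and Infinite_Set_Sum. *)
no_notation Infinite_Set_Sum.abs_summable_on (infix "abs'_summable'_on" 50)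

text \<open>Absolute summability of both factors carries over to the double family, so its unordered
  sum may be computed iteratively. Unordered double sums can then be regrouped along other index
  pairs.\<close>

lemma has_sum_times:
  fixes f :: "'a \<Rightarrow> complex" and g :: "'b \<Rightarrow> complex"
  assumes f: "f abs_summable_on A" and g: "g abs_summable_on B"
  shows "((\<lambda>(x, y). f x * g y) has_sum (infsum f A * infsum g B)) (A \<times> B)"
proof -
  have abs: "(\<lambda>(x, y). f x * g y) abs_summable_on A \<times> B"
    unfolding Infinite_Sum.abs_summable_on_Sigma_iff
    using f g by (auto simp: norm_mult abs_mult infsum_cmult_right' intro!: summable_on_cmult_right summable_on_cmult_left)
  show ?thesis
  proof (rule has_sum_SigmaI[where g = "\<lambda>x. f x * infsum g B"])
    show "((\<lambda>x. f x * infsum g B) has_sum infsum f A * infsum g B) A"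
      by (rule has_sum_cmult_left[OF has_sum_infsum[OF abs_summable_summable[OF f]]])
    show "(\<lambda>(x, y). f x * g y) summable_on A \<times> B"
      by (rule abs_summable_summable[OF abs])
    show "((\<lambda>y. case (x, y) of (x, y) \<Rightarrow> f x * g y) has_sum f x * infsum g B) B" for x
      using has_sum_cmult_right[OF has_sum_infsum[OF abs_summable_summable[OF g]]] by simp
  qed
qed

lemma bij_betw_int_nonneg: "bij_betw int UNIV {0..}"
  by (rule bij_betwI[where g = nat]) auto

lemma bij_betw_int_neg: "bij_betw (\<lambda>n. - int (Suc n)) UNIV {..<0}"
  by (rule bij_betwI[where g = "\<lambda>m. nat (- m - 1)"]) auto

lemma abs_summable_on_int:
  fixes f :: "int \<Rightarrow> complex"
  assumes "summable (\<lambda>n. norm (f (int n)))" "summable (\<lambda>n. norm (f (- int (Suc n))))"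
  shows "f abs_summable_on UNIV"
proof -
  have "(\<lambda>n. norm (f (int n))) summable_on UNIV" "(\<lambda>n. norm (f (- int (Suc n)))) summable_on UNIV"
    using assms by (auto intro!: norm_summable_imp_summable_on)
  hence "(\<lambda>n. norm (f n)) summable_on {0..}" "(\<lambda>n. norm (f n)) summable_on {..<0}"
    by (simp_all only: summable_on_reindex_bij_betw[OF bij_betw_int_nonneg, of "\<lambda>n. norm (f n)"]
          summable_on_reindex_bij_betw[OF bij_betw_int_neg, of "\<lambda>n. norm (f n)"])
  hence "(\<lambda>n. norm (f n)) summable_on ({0..} \<union> {..<0})"
    by (intro summable_on_Un_disjoint) auto
  also have "{0..} \<union> {..<0::int} = UNIV" by auto
  finally show ?thesis .
qed

lemma sums_int:
  fixes f :: "int \<Rightarrow> complex"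
  assumes "f abs_summable_on UNIV"
  shows "(\<lambda>n. f (int n)) sums infsum f {0..}"
    and "(\<lambda>n. f (- int (Suc n))) sums infsum f {..<0}"
    and "infsum f UNIV = infsum f {0..} + infsum f {..<0}"
proof -
  have s: "f summable_on S" for S
    using abs_summable_summable[OF assms] summable_on_subset_banach by blast
  show "(\<lambda>n. f (int n)) sums infsum f {0..}"
    using has_sum_infsum[OF s] by (intro has_sum_imp_sums)
      (simp only: has_sum_reindex_bij_betw[OF bij_betw_int_nonneg])
  show "(\<lambda>n. f (- int (Suc n))) sums infsum f {..<0}"
    using has_sum_infsum[OF s] by (intro has_sum_imp_sums)
      (simp only: has_sum_reindex_bij_betw[OF bij_betw_int_neg])
  have "infsum f ({0..} \<union> {..<0}) = infsum f {0..} + infsum f {..<0}"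
    by (intro infsum_Un_disjoint s) auto
  also have "{0..} \<union> {..<0::int} = UNIV" by auto
  finally show "infsum f UNIV = infsum f {0..} + infsum f {..<0}" .
qed

text \<open>Pairing \<open>n\<close> with \<open>- n\<close> leaves index 0 alone. This is the shape
  of \<open>theta4\<close> (a constant plus cosines) and of the Lambert series (sines only).\<close>

lemma sums_int_symmetric:
  fixes f :: "int \<Rightarrow> complex"
  assumes "f abs_summable_on UNIV"
  shows "(\<lambda>n. f (int (Suc n)) + f (- int (Suc n))) sums (infsum f UNIV - f 0)"
proof -
  have "(\<lambda>n. f (int (Suc n))) sums (infsum f {0..} - f 0)"
    using sums_int(1)[OF assms] by (subst sums_Suc_iff) simp
  from sums_add[OF this sums_int(2)[OF assms]] show ?thesis
    by (simp add: sums_int(3)[OF assms] algebra_simps)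
qed

section \<open>Coefficient families with Gaussian decay\<close>

definition gauss_decay :: "(int \<Rightarrow> complex) \<Rightarrow> bool" where
  "gauss_decay c \<longleftrightarrow>
     (\<exists>\<delta>>0. \<exists>C K. \<forall>m. norm (c m) \<le> C * exp (K * \<bar>real_of_int m\<bar> - \<delta> * (real_of_int m)\<^sup>2))"

text \<open>From \<open>n = (K + 1) / \<delta>\<close> on, the exponent is at most
  \<open>- n\<close>, so a geometric series dominates.\<close>

lemma summable_gauss: "\<delta> > 0 \<Longrightarrow> summable (\<lambda>n. exp (K * real n - \<delta> * (real n)\<^sup>2))"
proof (rule summable_comparison_test_ev)
  assume d: "\<delta> > 0"
  show "summable (\<lambda>n. exp (-1::real) ^ n)" by (rule summable_geometric) simp
  show "\<forall>\<^sub>F n in sequentially. norm (exp (K * real n - \<delta> * (real n)\<^sup>2)) \<le> exp (-1) ^ n"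
  proof (rule eventually_sequentiallyI)
    fix n assume "nat \<lceil>(K + 1) / \<delta>\<rceil> \<le> n"
    hence "(K + 1) / \<delta> \<le> n" by linarith
    hence "K + 1 \<le> \<delta> * n" using d by (simp add: field_simps)
    hence "(K + 1) * n \<le> (\<delta> * n) * n" by (intro mult_right_mono) auto
    thus "norm (exp (K * real n - \<delta> * (real n)\<^sup>2)) \<le> exp (-1) ^ n"
      by (simp add: exp_of_nat_mult [symmetric] power2_eq_square algebra_simps)
  qed
qed

lemma gauss_decay_abs_summable:
  assumes "gauss_decay c" shows "c abs_summable_on UNIV"
proof -
  from assms obtain \<delta> C K where d: "\<delta> > 0"
    and b: "\<And>m. norm (c m) \<le> C * exp (K * \<bar>real_of_int m\<bar> - \<delta> * (real_of_int m)\<^sup>2)"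
    unfolding gauss_decay_def by blast
  have s: "summable (\<lambda>n. C * exp (K * real n - \<delta> * (real n)\<^sup>2))"
    by (intro summable_mult summable_gauss d)
  show ?thesis
  proof (rule abs_summable_on_int)
    show "summable (\<lambda>n. norm (c (int n)))"
      by (rule summable_comparison_test'[OF s]) (use b[of "int _"] in simp)
    have "norm (norm (c (- int (Suc n)))) \<le> C * exp (K * real (Suc n) - \<delta> * (real (Suc n))\<^sup>2)" for n
      using b[of "- int (Suc n)"] by (simp add: power2_eq_square algebra_simps)
    thus "summable (\<lambda>n. norm (c (- int (Suc n))))"
      by (rule summable_comparison_test'[OF summable_Suc_iff[THEN iffD2, OF s]])
  qed
qed

text \<open>The rates of linear growth add up while \<open>\<delta>\<close> is unchanged. The free
  term in \<open>K\<close> in \<open>gauss_decay\<close> serves this closure: factors such as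
  \<open>exp (\<i> * m * z)\<close>, \<open>m\<close> or a power of \<open>q\<close> linear in
  \<open>m\<close> stay within the class.\<close>

lemma gauss_decay_mult:
  assumes "gauss_decay c" "\<And>m. norm (b m) \<le> C * exp (K * \<bar>real_of_int m\<bar>)"
  shows "gauss_decay (\<lambda>m. b m * c m)"
proof -
  from assms obtain \<delta> D L where d: "\<delta> > 0"
    and b: "\<And>m. norm (c m) \<le> D * exp (L * \<bar>real_of_int m\<bar> - \<delta> * (real_of_int m)\<^sup>2)"
    unfolding gauss_decay_def by blast
  have "norm (b m * c m) \<le> (C * D) * exp ((K + L) * \<bar>real_of_int m\<bar> - \<delta> * (real_of_int m)\<^sup>2)" for m
  proof -
    have "norm (b m) * norm (c m) \<le> (C * exp (K * \<bar>real_of_int m\<bar>)) * (D * exp (L * \<bar>real_of_int m\<bar> - \<delta> * (real_of_int m)\<^sup>2))"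
      by (rule mult_mono'[OF assms(2) b]) auto
    also have "\<dots> = (C * D) * exp (K * \<bar>real_of_int m\<bar> + (L * \<bar>real_of_int m\<bar> - \<delta> * (real_of_int m)\<^sup>2))"
      by (simp only: exp_add mult_ac)
    finally show ?thesis by (simp add: norm_mult algebra_simps)
  qed
  thus ?thesis unfolding gauss_decay_def using d by blast
qed

lemma norm_exp_int_le: "norm (exp (\<i> * of_int m * z)) \<le> 1 * exp (\<bar>Im z\<bar> * \<bar>real_of_int m\<bar>)"
proof -
  have "- (real_of_int m * Im z) \<le> \<bar>real_of_int m * Im z\<bar>" by linarith
  thus ?thesis by (simp add: norm_exp_eq_Re abs_mult mult_ac)
qed

lemma gauss_decay_exp:
  assumes "gauss_decay c" shows "gauss_decay (\<lambda>m. c m * exp (\<i> * of_int m * z))"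
  using gauss_decay_mult[OF assms norm_exp_int_le] by (simp add: mult.commute)

lemma gauss_decay_int:
  assumes "gauss_decay c" shows "gauss_decay (\<lambda>m. \<i> * of_int m * c m)"
proof (rule gauss_decay_mult[OF assms, where C = 1 and K = 1])
  fix m :: int
  have "\<bar>real_of_int m\<bar> \<le> exp \<bar>real_of_int m\<bar>" using exp_ge_add_one_self[of "\<bar>real_of_int m\<bar>"] by linarith
  thus "norm (\<i> * of_int m) \<le> 1 * exp (1 * \<bar>real_of_int m\<bar>)" by (simp add: norm_mult)
qed

section \<open>Fourier series and their termwise derivatives\<close>

definition fourier :: "(int \<Rightarrow> complex) \<Rightarrow> complex \<Rightarrow> complex" where
  "fourier c z = (\<Sum>\<^sub>\<infinity>m. c m * exp (\<i> * of_int m * z))"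

text \<open>For nonzero \<open>y\<close>, the power \<open>y ^ n\<close> is
  \<open>exp (\<i> * n * z)\<close> with \<open>z = - \<i> * Ln y\<close>, so this is half of an
  absolutely convergent Fourier series. It makes the power series entire, which termwise
  differentiation requires.\<close>

lemma gauss_decay_power_summable:
  assumes "gauss_decay c"
  shows "summable (\<lambda>n. c (int n) * y ^ n)"
proof (cases "y = 0")
  case True
  thus ?thesis by (simp add: power_0_left if_distrib cong: if_cong)
next
  case False
  have "(\<lambda>m. c m * exp (\<i> * of_int m * (- \<i> * Ln y))) abs_summable_on UNIV"
    by (intro gauss_decay_abs_summable gauss_decay_exp assms)
  from sums_int(1)[OF this] have "summable (\<lambda>n. c (int n) * exp (of_nat n * Ln y))"
    by (auto simp: sums_iff mult_ac)
  with False show ?thesis by (simp add: exp_of_nat_mult)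
qed

lemma gauss_decay_reflect:
  assumes "gauss_decay c" shows "gauss_decay (\<lambda>m. c (- m))"
proof -
  from assms obtain \<delta> D L where d: "\<delta> > 0"
    and b: "\<And>m. norm (c m) \<le> D * exp (L * \<bar>real_of_int m\<bar> - \<delta> * (real_of_int m)\<^sup>2)"
    unfolding gauss_decay_def by blast
  have "norm (c (- m)) \<le> D * exp (L * \<bar>real_of_int m\<bar> - \<delta> * (real_of_int m)\<^sup>2)" for m
    using b[of "- m"] by simp
  thus ?thesis unfolding gauss_decay_def using d by blast
qed

lemma powser_exp_has_field_derivative:
  fixes c :: "nat \<Rightarrow> complex"
  assumes "\<And>y. summable (\<lambda>n. c n * y ^ n)"
  shows "((\<lambda>z. \<Sum>n. c n * exp (a * z) ^ n) has_field_derivative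
           (\<Sum>n. a * of_nat n * c n * exp (a * z) ^ n)) (at z)"
proof -
  let ?y = "exp (a * z)"
  have s: "summable (\<lambda>n. diffs c n * ?y ^ n)"
    by (rule termdiff_converges_all[OF assms])
  have "(\<lambda>n. of_nat n * c n * ?y ^ (n - Suc 0)) sums (\<Sum>n. diffs c n * ?y ^ n)"
    by (rule diffs_equiv[OF s])
  \<comment> \<open>The chain rule factor \<open>a * ?y\<close> restores the power of
    \<open>?y\<close> lost in differentiating.\<close>
  from sums_mult[OF this, of "a * ?y"]
  have "(\<lambda>n. a * of_nat n * c n * ?y ^ n) sums (a * ?y * (\<Sum>n. diffs c n * ?y ^ n))"
  proof (rule sums_cong[THEN iffD1, rotated])
    fix n show "a * ?y * (of_nat n * c n * ?y ^ (n - Suc 0)) = a * of_nat n * c n * ?y ^ n"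
      by (cases n) (auto simp: mult_ac)
  qed
  hence eq: "(\<Sum>n. a * of_nat n * c n * ?y ^ n) = (\<Sum>n. diffs c n * ?y ^ n) * (?y * a)"
    by (simp add: sums_iff mult_ac)
  show ?thesis unfolding eq
    by (rule DERIV_chain2[where f = "\<lambda>y. \<Sum>n. c n * y ^ n"])
      (auto intro!: derivative_eq_intros termdiffs_strong_converges_everywhere assms)
qed

text \<open>Splitting by the sign of the frequency gives two entire power series, in
  \<open>exp (\<i> * z)\<close> and in its inverse, which can be differentiated termwise. Both
  contain index 0, hence the correction \<open>- c 0\<close>.\<close>

lemma fourier_eq_powser:
  assumes "gauss_decay c"
  shows "fourier c z = (\<Sum>n. c (int n) * exp (\<i> * z) ^ n) + (\<Sum>n. c (- int n) * exp (- \<i> * z) ^ n) - c 0"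
proof -
  let ?f = "\<lambda>m. c m * exp (\<i> * of_int m * z)"
  have s: "?f abs_summable_on UNIV"
    by (intro gauss_decay_abs_summable gauss_decay_exp assms)
  have f1: "?f (int n) = c (int n) * exp (\<i> * z) ^ n" for n
    by (simp add: exp_of_nat_mult [symmetric] mult_ac)
  have f2: "?f (- int n) = c (- int n) * exp (- \<i> * z) ^ n" for n
    by (simp add: exp_of_nat_mult [symmetric] mult_ac)
  have "(\<lambda>n. c (- int n) * exp (- \<i> * z) ^ n) sums (infsum ?f {..<0} + c 0)"
    using sums_int(2)[OF s] unfolding f2 by (subst (asm) sums_Suc_iff) simp
  moreover have "(\<lambda>n. c (int n) * exp (\<i> * z) ^ n) sums (infsum ?f {0..})"
    using sums_int(1)[OF s] unfolding f1 .
  ultimately show ?thesis unfolding fourier_def sums_int(3)[OF s] by (simp add: sums_iff)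
qed

lemma fourier_has_field_derivative:
  assumes "gauss_decay c"
  shows "(fourier c has_field_derivative fourier (\<lambda>m. \<i> * of_int m * c m) z) (at z)"
proof -
  have "((\<lambda>z. (\<Sum>n. c (int n) * exp (\<i> * z) ^ n) + (\<Sum>n. c (- int n) * exp (- \<i> * z) ^ n) - c 0)
     has_field_derivative (\<Sum>n. \<i> * of_nat n * c (int n) * exp (\<i> * z) ^ n)
        + (\<Sum>n. - \<i> * of_nat n * c (- int n) * exp (- \<i> * z) ^ n) - 0) (at z)"
    by (intro DERIV_add DERIV_diff powser_exp_has_field_derivative DERIV_const
          gauss_decay_power_summable[OF assms] gauss_decay_power_summable[OF gauss_decay_reflect[OF assms]])
  thus ?thesis
    by (simp add: fourier_eq_powser[OF assms, abs_def] fourier_eq_powser[OF gauss_decay_int[OF assms]])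
qed

section \<open>Theta functions and their product formulas\<close>

lemma qpow_add: "qpow \<tau> (a + b) = qpow \<tau> a * qpow \<tau> b"
  by (simp add: qpow_def exp_add [symmetric] algebra_simps)

lemma qpow_0 [simp]: "qpow \<tau> 0 = 1"
  by (simp add: qpow_def)

lemma norm_qpow: "norm (qpow \<tau> a) = exp (- 2 * pi * a * Im \<tau>)"
  by (simp add: qpow_def norm_exp_eq_Re)

lemma gauss_decay_qpow:
  assumes "Im \<tau> > 0" "\<kappa> > 0" "\<And>m. norm (c m) \<le> norm (qpow \<tau> (\<kappa> * (real_of_int m)\<^sup>2))"
  shows "gauss_decay c"
  unfolding gauss_decay_def
proof (intro exI conjI allI)
  show "2 * pi * \<kappa> * Im \<tau> > 0" using assms by simp
  show "norm (c m) \<le> 1 * exp (0 * \<bar>real_of_int m\<bar> - 2 * pi * \<kappa> * Im \<tau> * (real_of_int m)\<^sup>2)" for m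
    using assms(3)[of m] by (simp add: norm_qpow mult_ac)
qed

lemma has_sum_diff:
  fixes f g :: "'a \<Rightarrow> complex"
  assumes "(f has_sum a) A" "(g has_sum b) A"
  shows "((\<lambda>x. f x - g x) has_sum (a - b)) A"
  using has_sum_add[OF assms(1) has_sum_cmult_right[OF assms(2), of "- 1"]] by simp

lemma fourier_has_sum:
  assumes "gauss_decay c"
  shows "((\<lambda>m. c m * exp (\<i> * of_int m * z)) has_sum fourier c z) UNIV"
  unfolding fourier_def
  by (rule has_sum_infsum[OF abs_summable_summable[OF gauss_decay_abs_summable[OF gauss_decay_exp[OF assms]]]])

lemma fourier_mult_has_sum:
  assumes "gauss_decay c" "gauss_decay d"
  shows "((\<lambda>(j, l). c j * d l * exp (\<i> * (of_int j * x + of_int l * y)))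
           has_sum fourier c x * fourier d y) UNIV"
proof -
  have "((\<lambda>(j, l). (c j * exp (\<i> * of_int j * x)) * (d l * exp (\<i> * of_int l * y)))
           has_sum fourier c x * fourier d y) (UNIV \<times> UNIV)"
    unfolding fourier_def
    by (intro has_sum_times gauss_decay_abs_summable gauss_decay_exp assms)
  thus ?thesis by (simp add: exp_add distrib_left mult_ac)
qed

text \<open>The substitution \<open>(m, n) = (j + l, j - l)\<close> reaches exactly the pairs with
  even sum; the hypothesis on \<open>c\<close> removes the others. It holds when all frequencies of
  \<open>c\<close> have the same parity.\<close>

lemma fourier_mult_rotated_has_sum:
  assumes "gauss_decay c" and z: "\<And>m n. odd (m + n) \<Longrightarrow> c m * c n = 0"
  shows "((\<lambda>(j, l). c (j + l) * c (j - l) * exp (\<i> * (of_int j * (x + y) + of_int l * (x - y))))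
           has_sum fourier c x * fourier c y) UNIV"
proof -
  let ?E = "{(m :: int, n :: int). even (m + n)}"
  let ?f = "\<lambda>(m, n). c m * c n * exp (\<i> * (of_int m * x + of_int n * y))"
  have "(?f has_sum fourier c x * fourier c y) ?E"
    by (rule has_sum_cong_neutral[THEN iffD1, OF _ _ _ fourier_mult_has_sum[OF assms(1,1)]])
      (use z in fastforce)+
  thus ?thesis
  proof (rule has_sum_reindex_bij_witness[THEN iffD1, rotated -1])
    show "(\<lambda>(m, n). ((m + n) div 2, (m - n) div 2)) a \<in> UNIV" for a :: "int \<times> int" by simp
    show "(\<lambda>(j, l). (j + l, j - l)) b \<in> ?E" for b by (auto split: prod.splits)
    show "(\<lambda>(m, n). ((m + n) div 2, (m - n) div 2)) ((\<lambda>(j, l). (j + l, j - l)) b) = b" for b :: "int \<times> int"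
      by (auto split: prod.splits)
    show *: "(\<lambda>(j, l). (j + l, j - l)) ((\<lambda>(m, n). ((m + n) div 2, (m - n) div 2)) a) = a" if "a \<in> ?E" for a
      using that by (auto split: prod.splits elim!: evenE) presburger+
    fix a :: "int \<times> int" assume a: "a \<in> ?E"
    obtain j l where jl: "(\<lambda>(m, n). ((m + n) div 2, (m - n) div 2)) a = (j, l)"
      by (rule prod.exhaust)
    with *[OF a] have "a = (j + l, j - l)" by simp
    with jl show "(case (\<lambda>(m, n). ((m + n) div 2, (m - n) div 2)) a of
       (j, l) \<Rightarrow> c (j + l) * c (j - l) * exp (\<i> * (of_int j * (x + y) + of_int l * (x - y)))) = ?f a"
      by (simp add: algebra_simps)
  qed simp
qed

lemma fourier_uminus:
  assumes "\<And>m. c (- m) = c m"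
  shows "fourier c (- z) = fourier c z"
  unfolding fourier_def
  by (rule infsum_reindex_bij_witness[of _ uminus uminus]) (auto simp: assms)

text \<open>
  Coefficients of \<open>e\<^bsup>imz\<^esup>\<close> in \<open>\<theta>\<^sub>4(z|\<tau>)\<close>, \<open>\<theta>\<^sub>1(z|\<tau>)\<close>, \<open>\<theta>\<^sub>3(z|2\<tau>)\<close> and \<open>\<theta>\<^sub>2(z|2\<tau>)\<close>. Indexing by the
  frequency \<open>m\<close> turns the alternating signs of the first two into \<open>\<i>\<^sup>m\<close>.
\<close>

definition coeff4 :: "complex \<Rightarrow> int \<Rightarrow> complex" where
  "coeff4 \<tau> m = (if even m then \<i> powi m * qpow \<tau> ((real_of_int m)\<^sup>2 / 8) else 0)"

definition coeff1 :: "complex \<Rightarrow> int \<Rightarrow> complex" where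
  "coeff1 \<tau> m = (if odd m then - (\<i> powi m * qpow \<tau> ((real_of_int m)\<^sup>2 / 8)) else 0)"

definition coeffA :: "complex \<Rightarrow> int \<Rightarrow> complex" where
  "coeffA \<tau> m = (if even m then qpow \<tau> ((real_of_int m)\<^sup>2 / 4) else 0)"

definition coeffB :: "complex \<Rightarrow> int \<Rightarrow> complex" where
  "coeffB \<tau> m = (if odd m then qpow \<tau> ((real_of_int m)\<^sup>2 / 4) else 0)"

lemma gauss_decay_coeff:
  assumes "Im \<tau> > 0"
  shows "gauss_decay (coeff4 \<tau>)" "gauss_decay (coeff1 \<tau>)" "gauss_decay (coeffA \<tau>)" "gauss_decay (coeffB \<tau>)"
proof -
  show "gauss_decay (coeff4 \<tau>)" "gauss_decay (coeff1 \<tau>)"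
    by (rule gauss_decay_qpow[OF assms, of "1/8"]; simp add: coeff4_def coeff1_def norm_mult norm_power_int)+
  show "gauss_decay (coeffA \<tau>)" "gauss_decay (coeffB \<tau>)"
    by (rule gauss_decay_qpow[OF assms, of "1/4"]; simp add: coeffA_def coeffB_def)+
qed

text \<open>The exponents add up to \<open>2 * j\<close>, so only the parity of \<open>j\<close>
  matters. In the rotated products it selects the A or B coefficient at \<open>j\<close> and the
  sign of the term.\<close>

lemma i_powi_mult: "\<i> powi (j + l) * \<i> powi (j - l) = (if even j then 1 else - 1)"
proof -
  have "\<i> powi (j + l) * \<i> powi (j - l) = \<i> powi ((j + l) + (j - l))"
    by (rule power_int_add [symmetric]) simp
  also have "(j + l) + (j - l) = 2 * j" by simp
  also have "\<i> powi (2 * j) = (if even j then 1 else - 1)"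
    by (subst power_int_mult) (simp add: power_int_minus_left)
  finally show ?thesis .
qed

text \<open>Parallelogram law: the squares of \<open>j + l\<close> and \<open>j - l\<close> add up
  to twice those of \<open>j\<close> and \<open>l\<close>. The doubling accounts for the parameter
  \<open>2 * \<tau>\<close> of A and B.\<close>

lemma qpow_squares_rotate:
  "qpow \<tau> ((real_of_int (j + l))\<^sup>2 / 8) * qpow \<tau> ((real_of_int (j - l))\<^sup>2 / 8) =
     qpow \<tau> ((real_of_int j)\<^sup>2 / 4) * qpow \<tau> ((real_of_int l)\<^sup>2 / 4)"
  unfolding qpow_add [symmetric] by (rule arg_cong[where f = "qpow \<tau>"]) (simp add: power2_eq_square field_simps)

lemma coeff4_rotate:
  "coeff4 \<tau> (j + l) * coeff4 \<tau> (j - l) = coeffA \<tau> j * coeffA \<tau> l - coeffB \<tau> j * coeffB \<tau> l"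
proof (cases "even (j + l)")
  case True
  hence "coeff4 \<tau> (j + l) * coeff4 \<tau> (j - l) = (\<i> powi (j + l) * \<i> powi (j - l)) *
    (qpow \<tau> ((real_of_int (j + l))\<^sup>2 / 8) * qpow \<tau> ((real_of_int (j - l))\<^sup>2 / 8))"
    unfolding coeff4_def by simp
  with True show ?thesis unfolding qpow_squares_rotate i_powi_mult by (auto simp: coeffA_def coeffB_def)
qed (auto simp: coeff4_def coeffA_def coeffB_def)

lemma coeff1_rotate:
  "coeff1 \<tau> (j + l) * coeff1 \<tau> (j - l) = coeffA \<tau> j * coeffB \<tau> l - coeffB \<tau> j * coeffA \<tau> l"
proof (cases "odd (j + l)")
  case True
  hence "coeff1 \<tau> (j + l) * coeff1 \<tau> (j - l) = (\<i> powi (j + l) * \<i> powi (j - l)) *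
    (qpow \<tau> ((real_of_int (j + l))\<^sup>2 / 8) * qpow \<tau> ((real_of_int (j - l))\<^sup>2 / 8))"
    unfolding coeff1_def by simp
  with True show ?thesis unfolding qpow_squares_rotate i_powi_mult by (auto simp: coeffA_def coeffB_def)
qed (auto simp: coeff1_def coeffA_def coeffB_def)

text \<open>One double family is summed twice: as the product on the left and, after
  \<open>coeff4_rotate\<close>, as a difference of two products in the variables
  \<open>x + y\<close> and \<open>x - y\<close>.\<close>

lemma fourier_coeff4_mult:
  assumes "Im \<tau> > 0"
  shows "fourier (coeff4 \<tau>) x * fourier (coeff4 \<tau>) y =
    fourier (coeffA \<tau>) (x + y) * fourier (coeffA \<tau>) (x - y) - fourier (coeffB \<tau>) (x + y) * fourier (coeffB \<tau>) (x - y)"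
proof (rule has_sum_unique)
  note g = gauss_decay_coeff[OF assms]
  show "((\<lambda>(j, l). coeff4 \<tau> (j + l) * coeff4 \<tau> (j - l) * exp (\<i> * (of_int j * (x + y) + of_int l * (x - y))))
           has_sum fourier (coeff4 \<tau>) x * fourier (coeff4 \<tau>) y) UNIV"
    by (rule fourier_mult_rotated_has_sum[OF g(1)]) (auto simp: coeff4_def)
  show "((\<lambda>(j, l). coeff4 \<tau> (j + l) * coeff4 \<tau> (j - l) * exp (\<i> * (of_int j * (x + y) + of_int l * (x - y))))
           has_sum fourier (coeffA \<tau>) (x + y) * fourier (coeffA \<tau>) (x - y)
             - fourier (coeffB \<tau>) (x + y) * fourier (coeffB \<tau>) (x - y)) UNIV"
    using has_sum_diff[OF fourier_mult_has_sum[OF g(3,3)] fourier_mult_has_sum[OF g(4,4)]]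
    by (simp add: coeff4_rotate case_prod_unfold left_diff_distrib)
qed

lemma fourier_coeff1_mult:
  assumes "Im \<tau> > 0"
  shows "fourier (coeff1 \<tau>) x * fourier (coeff1 \<tau>) y =
    fourier (coeffA \<tau>) (x + y) * fourier (coeffB \<tau>) (x - y) - fourier (coeffB \<tau>) (x + y) * fourier (coeffA \<tau>) (x - y)"
proof (rule has_sum_unique)
  note g = gauss_decay_coeff[OF assms]
  show "((\<lambda>(j, l). coeff1 \<tau> (j + l) * coeff1 \<tau> (j - l) * exp (\<i> * (of_int j * (x + y) + of_int l * (x - y))))
           has_sum fourier (coeff1 \<tau>) x * fourier (coeff1 \<tau>) y) UNIV"
    by (rule fourier_mult_rotated_has_sum[OF g(2)]) (auto simp: coeff1_def)
  show "((\<lambda>(j, l). coeff1 \<tau> (j + l) * coeff1 \<tau> (j - l) * exp (\<i> * (of_int j * (x + y) + of_int l * (x - y))))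
           has_sum fourier (coeffA \<tau>) (x + y) * fourier (coeffB \<tau>) (x - y)
             - fourier (coeffB \<tau>) (x + y) * fourier (coeffA \<tau>) (x - y)) UNIV"
    using has_sum_diff[OF fourier_mult_has_sum[OF g(3,4)] fourier_mult_has_sum[OF g(4,3)]]
    by (simp add: coeff1_rotate case_prod_unfold left_diff_distrib)
qed

section \<open>The theta series as Fourier series\<close>

lemma fourier_coeff4_halved:
  "fourier (coeff4 \<tau>) z = fourier (\<lambda>a. (- 1) powi a * qpow \<tau> ((real_of_int a)\<^sup>2 / 2)) (2 * z)"
proof -
  have "fourier (coeff4 \<tau>) z = (\<Sum>\<^sub>\<infinity>m\<in>{m. even m}. coeff4 \<tau> m * exp (\<i> * of_int m * z))"
    unfolding fourier_def by (rule infsum_cong_neutral) (auto simp: coeff4_def)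
  \<comment> \<open>With \<open>m = 2 * a\<close>, the factor \<open>\<i> powi m\<close> becomes
    \<open>(- 1) powi a\<close>, and \<open>m^2 / 8\<close> becomes \<open>a^2 / 2\<close>.\<close>
  also have "\<dots> = fourier (\<lambda>a. (- 1) powi a * qpow \<tau> ((real_of_int a)\<^sup>2 / 2)) (2 * z)"
    unfolding fourier_def
    by (rule infsum_reindex_bij_witness[of _ "\<lambda>a. 2 * a" "\<lambda>m. m div 2"])
       (auto simp: coeff4_def power_int_mult power_mult_distrib elim!: evenE, simp add: mult_ac)
  finally show ?thesis .
qed

lemma gauss_decay_alternating:
  assumes "Im \<tau> > 0"
  shows "gauss_decay (\<lambda>a. (- 1) powi a * qpow \<tau> ((real_of_int a)\<^sup>2 / 2))"
  by (rule gauss_decay_qpow[OF assms, of "1/2"]) (simp_all add: norm_mult norm_power_int)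

lemma theta4_eq_fourier:
  assumes "Im \<tau> > 0"
  shows "theta4 z \<tau> = fourier (coeff4 \<tau>) z"
proof -
  let ?f = "\<lambda>a. (- 1) powi a * qpow \<tau> ((real_of_int a)\<^sup>2 / 2) * exp (\<i> * of_int a * (2 * z))"
  have "?f abs_summable_on UNIV"
    by (intro gauss_decay_abs_summable gauss_decay_exp gauss_decay_alternating assms)
  from sums_int_symmetric[OF this]
  have "(\<lambda>n. ?f (int (Suc n)) + ?f (- int (Suc n))) sums (fourier (coeff4 \<tau>) z - 1)"
    by (simp add: fourier_coeff4_halved) (simp add: fourier_def)
  also have "(\<lambda>n. ?f (int (Suc n)) + ?f (- int (Suc n))) =
    (\<lambda>n. 2 * ((- 1) ^ Suc n * qpow \<tau> ((real (Suc n))\<^sup>2 / 2) * cos (2 * of_nat (Suc n) * z)))"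
  proof
    fix n
    have "(- 1 :: complex) powi (- int (Suc n)) = (- 1) ^ Suc n"
      by (simp only: power_int_minus power_int_of_nat) (simp flip: power_inverse)
    moreover have "(real_of_int (- int (Suc n)))\<^sup>2 = (real (Suc n))\<^sup>2" "(- 1 :: complex) powi int (Suc n) = (- 1) ^ Suc n"
      by (simp_all only: of_int_minus of_int_of_nat_eq power2_minus power_int_of_nat)
    ultimately show "?f (int (Suc n)) + ?f (- int (Suc n)) =
      2 * ((- 1) ^ Suc n * qpow \<tau> ((real (Suc n))\<^sup>2 / 2) * cos (2 * of_nat (Suc n) * z))"
      by (simp only: of_int_of_nat_eq) (simp add: cos_exp_eq field_simps)
  qed
  finally have "2 * (\<Sum>n. (- 1) ^ Suc n * qpow \<tau> ((real (Suc n))\<^sup>2 / 2) * cos (2 * of_nat (Suc n) * z)) = fourier (coeff4 \<tau>) z - 1"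
    by (subst suminf_mult [symmetric]) (auto simp: sums_iff simp del: of_nat_Suc power_Suc)
  thus ?thesis by (simp only: theta4_def) simp
qed

lemma theta1_eq_fourier:
  assumes "Im \<tau> > 0"
  shows "theta1 z \<tau> = fourier (coeff1 \<tau>) z"
proof -
  let ?f = "\<lambda>m. coeff1 \<tau> m * exp (\<i> * of_int m * z)"
  let ?g = "\<lambda>a. ?f (2 * a + 1)"
  have "(?f has_sum fourier (coeff1 \<tau>) z) {m. odd m}"
    by (rule has_sum_cong_neutral[THEN iffD1, OF _ _ _ fourier_has_sum[OF gauss_decay_coeff(2)[OF assms]]])
       (auto simp: coeff1_def)
  hence g: "(?g has_sum fourier (coeff1 \<tau>) z) UNIV"
    by (rule has_sum_reindex_bij_witness[of _ "\<lambda>a. 2 * a + 1" "\<lambda>m. m div 2", THEN iffD1, rotated -1]) auto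
  have abs: "?g abs_summable_on UNIV"
    using has_sum_imp_summable[OF g] by (simp only: summable_on_iff_abs_summable_on_complex)
  \<comment> \<open>Under \<open>m = 2 * a + 1\<close> the indices \<open>n\<close> and
    \<open>- Suc n\<close> are the opposite frequencies \<open>2 * n + 1\<close> and
    \<open>- (2 * n + 1)\<close>, whose terms combine to a sine.\<close>
  have "(\<lambda>n. ?g (int n) + ?g (- int (Suc n))) sums fourier (coeff1 \<tau>) z"
    using sums_add[OF sums_int(1,2)[OF abs]] infsumI[OF g] sums_int(3)[OF abs] by simp
  also have "(\<lambda>n. ?g (int n) + ?g (- int (Suc n))) =
    (\<lambda>n. 2 * ((- 1) ^ n * qpow \<tau> ((2 * real n + 1)\<^sup>2 / 8) * sin ((2 * of_nat n + 1) * z)))"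
  proof
    fix n
    have 1: "coeff1 \<tau> (2 * int n + 1) = - (\<i> * (- 1) ^ n * qpow \<tau> ((2 * real n + 1)\<^sup>2 / 8))"
      by (simp add: coeff1_def power_int_add power_int_mult)
    have e: "2 * (- int (Suc n)) + 1 = - (2 * int n + 1)" by simp
    have "\<i> powi (2 * int n + 1) = \<i> * (- 1) ^ n"
      by (simp add: power_int_add power_int_mult)
    hence "\<i> powi (- (2 * int n + 1)) = - (\<i> * (- 1) ^ n)"
      by (simp only: power_int_minus) (simp flip: power_inverse)
    moreover have "(real_of_int (- (2 * int n + 1)))\<^sup>2 = (2 * real n + 1)\<^sup>2"
      by (simp add: power2_eq_square algebra_simps)
    ultimately have 2: "coeff1 \<tau> (- (2 * int n + 1)) = \<i> * (- 1) ^ n * qpow \<tau> ((2 * real n + 1)\<^sup>2 / 8)"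
      unfolding coeff1_def by simp
    show "?g (int n) + ?g (- int (Suc n)) =
      2 * ((- 1) ^ n * qpow \<tau> ((2 * real n + 1)\<^sup>2 / 8) * sin ((2 * of_nat n + 1) * z))"
      unfolding e 1 2 by (simp add: sin_exp_eq field_simps)
  qed
  finally show ?thesis unfolding theta1_def
    by (subst suminf_mult [symmetric]) (auto simp: sums_iff)
qed

section \<open>The identity for logarithmic derivatives\<close>

lemma theta4_has_field_derivative:
  assumes "Im \<tau> > 0"
  shows "((\<lambda>z. theta4 z \<tau>) has_field_derivative deriv (\<lambda>z. theta4 z \<tau>) z) (at z)"
proof -
  have eq: "(\<lambda>z. theta4 z \<tau>) = fourier (coeff4 \<tau>)"
    by (rule ext) (rule theta4_eq_fourier[OF assms])
  note d = fourier_has_field_derivative[OF gauss_decay_coeff(1)[OF assms], of z]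
  show ?thesis unfolding eq DERIV_imp_deriv[OF d] by (rule d)
qed

lemma theta1_has_field_derivative:
  assumes "Im \<tau> > 0"
  shows "((\<lambda>z. theta1 z \<tau>) has_field_derivative deriv (\<lambda>z. theta1 z \<tau>) z) (at z)"
proof -
  have eq: "(\<lambda>z. theta1 z \<tau>) = fourier (coeff1 \<tau>)"
    by (rule ext) (rule theta1_eq_fourier[OF assms])
  note d = fourier_has_field_derivative[OF gauss_decay_coeff(2)[OF assms], of z]
  show ?thesis unfolding eq DERIV_imp_deriv[OF d] by (rule d)
qed

text \<open>The denominators are cleared and the points grouped as \<open>(s, t)\<close> and
  \<open>(u, v)\<close>, so that only products of two theta values and derivatives of such products
  occur; all of these are expressible by A and B.\<close>

lemma theta_derivative_identity:
  assumes tau: "Im \<tau> > 0" and sum0: "s + t + u + v = 0"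
  defines "T \<equiv> \<lambda>z. theta4 z \<tau>" and "T' \<equiv> deriv (\<lambda>z. theta4 z \<tau>)"
  shows "(T' s * T t + T s * T' t) * (T u * T v) + (T s * T t) * (T' u * T v + T u * T' v) =
    - (vartheta1' \<tau> * theta1 (s + t) \<tau> * theta1 (s + u) \<tau> * theta1 (s + v) \<tau>)"
proof -
  define A B A' B' where "A = fourier (coeffA \<tau>)" and "B = fourier (coeffB \<tau>)"
    and "A' = fourier (\<lambda>m. \<i> * of_int m * coeffA \<tau> m)" and "B' = fourier (\<lambda>m. \<i> * of_int m * coeffB \<tau> m)"
  define p d e where "p = s + t" and "d = s - t" and "e = u - v"
  have dA: "(A has_field_derivative A' z) (at z)" and dB: "(B has_field_derivative B' z) (at z)" for z
    unfolding A_def B_def A'_def B'_def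
    by (rule fourier_has_field_derivative gauss_decay_coeff tau)+
  have dT: "(T has_field_derivative T' z) (at z)" for z
    unfolding T_def T'_def by (rule theta4_has_field_derivative[OF tau])
  have evenA: "A (- z) = A z" and evenB: "B (- z) = B z" for z
    unfolding A_def B_def by (rule fourier_uminus; simp add: coeffA_def coeffB_def)+
  have T: "T x * T y = A (x + y) * A (x - y) - B (x + y) * B (x - y)" for x y
    unfolding T_def A_def B_def theta4_eq_fourier[OF tau] by (rule fourier_coeff4_mult[OF tau])
  have T1: "theta1 x \<tau> * theta1 y \<tau> = A (x + y) * B (x - y) - B (x + y) * A (x - y)" for x y
    unfolding A_def B_def theta1_eq_fourier[OF tau] by (rule fourier_coeff1_mult[OF tau])

  \<comment> \<open>Moving \<open>s\<close> and \<open>t\<close> by the same \<open>h\<close> fixes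
    \<open>s - t\<close>, so only the factors at \<open>s + t\<close> are differentiated.\<close>
  have st: "T' s * T t + T s * T' t = 2 * (A' p * A d - B' p * B d)"
  proof (rule DERIV_unique)
    show "((\<lambda>h. T (s + h) * T (t + h)) has_field_derivative T' s * T t + T s * T' t) (at 0)"
      by (auto intro!: derivative_eq_intros DERIV_chain2[OF dT])
    have "(\<lambda>h. T (s + h) * T (t + h)) = (\<lambda>h. A (p + 2 * h) * A d - B (p + 2 * h) * B d)"
      unfolding T by (simp add: p_def d_def algebra_simps)
    thus "((\<lambda>h. T (s + h) * T (t + h)) has_field_derivative 2 * (A' p * A d - B' p * B d)) (at 0)"
      by (auto intro!: derivative_eq_intros DERIV_chain2[OF dA] DERIV_chain2[OF dB] simp: algebra_simps)
  qed
  \<comment> \<open>Here the shift is \<open>- h\<close>: then \<open>u + v\<close> becomes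
    \<open>- (p + 2 * h)\<close>, and evenness of A and B leads back to the argument
    \<open>p + 2 * h\<close>. The outer minus sign compensates for the direction.\<close>
  have uv: "T' u * T v + T u * T' v = - (2 * (A' p * A e - B' p * B e))"
  proof (rule DERIV_unique)
    show "((\<lambda>h. - (T (u - h) * T (v - h))) has_field_derivative T' u * T v + T u * T' v) (at 0)"
      by (auto intro!: derivative_eq_intros DERIV_chain2[OF dT])
    have "(u - h) + (v - h) = - (p + 2 * h)" for h
      using sum0 unfolding p_def by (simp add: algebra_simps add_eq_0_iff)
    hence "(\<lambda>h. T (u - h) * T (v - h)) = (\<lambda>h. A (p + 2 * h) * A e - B (p + 2 * h) * B e)"
      unfolding T by (simp only: evenA evenB) (simp add: e_def)
    hence eq: "(\<lambda>h. - (T (u - h) * T (v - h))) = (\<lambda>h. - (A (p + 2 * h) * A e - B (p + 2 * h) * B e))"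
      by (simp add: fun_eq_iff)
    show "((\<lambda>h. - (T (u - h) * T (v - h))) has_field_derivative - (2 * (A' p * A e - B' p * B e))) (at 0)"
      unfolding eq by (auto intro!: derivative_eq_intros DERIV_chain2[OF dA] DERIV_chain2[OF dB] simp: algebra_simps)
  qed
  \<comment> \<open>The product formula is differentiated in \<open>y\<close> at 0, where
    \<open>p + y\<close> and \<open>p - y\<close> both equal \<open>p\<close>.\<close>
  have T1p: "vartheta1' \<tau> * theta1 p \<tau> = 2 * (A' p * B p - A p * B' p)"
  proof (rule DERIV_unique)
    show "((\<lambda>y. theta1 p \<tau> * theta1 y \<tau>) has_field_derivative vartheta1' \<tau> * theta1 p \<tau>) (at 0)"
      unfolding vartheta1'_def
      using DERIV_cmult[OF theta1_has_field_derivative[OF tau, of 0], of "theta1 p \<tau>"] by (simp add: mult_ac)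
    show "((\<lambda>y. theta1 p \<tau> * theta1 y \<tau>) has_field_derivative 2 * (A' p * B p - A p * B' p)) (at 0)"
      unfolding T1
      by (auto intro!: derivative_eq_intros DERIV_chain2[OF dA] DERIV_chain2[OF dB] simp: algebra_simps)
  qed
  have "u + v = - p" using sum0 unfolding p_def by (simp add: algebra_simps add_eq_0_iff)
  hence Tuv: "T u * T v = A p * A e - B p * B e" and Tst: "T s * T t = A p * A d - B p * B d"
    unfolding T by (simp_all only: evenA evenB e_def p_def [symmetric] d_def)
  have "(s + u) + (s + v) = d" "(s + u) - (s + v) = e"
    using sum0 unfolding d_def e_def by (simp_all add: algebra_simps add_eq_0_iff)
  hence T1e: "theta1 (s + u) \<tau> * theta1 (s + v) \<tau> = A d * B e - B d * A e"
    unfolding T1 by simp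
  have "vartheta1' \<tau> * theta1 (s + t) \<tau> * theta1 (s + u) \<tau> * theta1 (s + v) \<tau> =
      (vartheta1' \<tau> * theta1 p \<tau>) * (theta1 (s + u) \<tau> * theta1 (s + v) \<tau>)"
    by (simp add: p_def)
  \<comment> \<open>The products involving only A, and those involving only B, cancel; the remaining
    four terms factor.\<close>
  thus ?thesis unfolding st uv Tuv Tst T1p T1e by (simp add: algebra_simps)
qed

section \<open>Translation by multiples of pi\<close>

lemma exp_int_pi: "exp (\<i> * of_int m * (of_int k * of_real pi)) = (- 1) powi (m * k)"
proof -
  have "(- 1) powi (m * k) = exp (of_real pi * \<i>) powi (m * k)"
    by simp
  also have "\<dots> = exp (of_int (m * k) * (of_real pi * \<i>))"
    by (rule exp_power_int)
  finally show ?thesis by (simp add: mult_ac)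
qed

lemma theta4_add_int_pi:
  assumes "Im \<tau> > 0"
  shows "theta4 (z + of_int k * of_real pi) \<tau> = theta4 z \<tau>"
  unfolding theta4_eq_fourier[OF assms] fourier_def
  by (intro infsum_cong) (auto simp: coeff4_def distrib_left exp_add exp_int_pi power_int_minus_left)

text \<open>The frequency \<open>m\<close> picks up \<open>(- 1) powi (m * k)\<close>, which is
  \<open>(- 1) powi k\<close> for every odd \<open>m\<close>.\<close>

lemma theta1_add_int_pi:
  assumes "Im \<tau> > 0"
  shows "theta1 (z + of_int k * of_real pi) \<tau> = (- 1) powi k * theta1 z \<tau>"
  unfolding theta1_eq_fourier[OF assms] fourier_def infsum_cmult_right' [symmetric]
  by (intro infsum_cong) (auto simp: coeff1_def distrib_left exp_add exp_int_pi power_int_minus_left)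

lemma log_theta4'_add_int_pi:
  assumes "Im \<tau> > 0"
  shows "log_theta4' (z + of_int k * of_real pi) \<tau> = log_theta4' z \<tau>"
proof -
  have "((\<lambda>w. theta4 (w + of_int k * of_real pi) \<tau>) has_field_derivative
          deriv (\<lambda>w. theta4 w \<tau>) (z + of_int k * of_real pi)) (at z)"
    using theta4_has_field_derivative[OF assms, of "z + of_int k * of_real pi"] by (simp add: DERIV_shift)
  hence "deriv (\<lambda>w. theta4 w \<tau>) z = deriv (\<lambda>w. theta4 w \<tau>) (z + of_int k * of_real pi)"
    by (intro DERIV_imp_deriv) (simp add: theta4_add_int_pi[OF assms])
  thus ?thesis by (simp add: log_theta4'_def theta4_add_int_pi[OF assms])
qed

text \<open>Replacing \<open>v\<close> by \<open>v - k * pi\<close> makes the sum of the points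
  zero. Of all the factors only \<open>theta1 (s + v)\<close> is affected, by the sign
  \<open>(- 1) powi k\<close>, which therefore appears in the formula.\<close>

lemma sum_log_theta4':
  assumes tau: "Im \<tau> > 0" and sum: "s + t + u + v = of_int k * of_real pi"
    and nz: "theta4 s \<tau> * theta4 t \<tau> * theta4 u \<tau> * theta4 v \<tau> \<noteq> 0"
  shows "log_theta4' s \<tau> + log_theta4' t \<tau> + log_theta4' u \<tau> + log_theta4' v \<tau> =
      (- 1) powi k *
      (- (vartheta1' \<tau> * theta1 (s + t) \<tau> * theta1 (s + u) \<tau> * theta1 (s + v) \<tau>
        / (theta4 s \<tau> * theta4 t \<tau> * theta4 u \<tau> * theta4 v \<tau>)))"
proof -
  define w where "w = v + of_int (- k) * of_real pi"
  have sum0: "s + t + u + w = 0"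
    using sum by (simp add: w_def algebra_simps)
  have T: "theta4 w \<tau> = theta4 v \<tau>" and L: "log_theta4' w \<tau> = log_theta4' v \<tau>"
    unfolding w_def by (rule theta4_add_int_pi[OF tau], rule log_theta4'_add_int_pi[OF tau])
  have "theta1 (s + w) \<tau> = (- 1) powi (- k) * theta1 (s + v) \<tau>"
    using theta1_add_int_pi[OF tau, of "s + v" "- k"] unfolding w_def by (simp only: add.assoc)
  hence T1: "theta1 (s + w) \<tau> = (- 1) powi k * theta1 (s + v) \<tau>"
    by (simp add: power_int_minus_left power_int_minus)
  have "log_theta4' s \<tau> + log_theta4' t \<tau> + log_theta4' u \<tau> + log_theta4' w \<tau> =
     - (vartheta1' \<tau> * theta1 (s + t) \<tau> * theta1 (s + u) \<tau> * theta1 (s + w) \<tau>)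
        / (theta4 s \<tau> * theta4 t \<tau> * theta4 u \<tau> * theta4 w \<tau>)"
    unfolding theta_derivative_identity[OF tau sum0, symmetric] log_theta4'_def
    using nz by (simp add: T divide_simps) (simp add: algebra_simps)
  thus ?thesis unfolding T L T1 by simp
qed

section \<open>The Lambert series\<close>

lemma qpow_nonzero [simp]: "qpow \<tau> a \<noteq> 0"
  by (simp add: qpow_def)

text \<open>Since \<open>1 / 0 = 0\<close>, the index \<open>k = 0\<close> drops out of all sums below.\<close>

definition lambert_coeff :: "complex \<Rightarrow> int \<Rightarrow> complex" where
  "lambert_coeff \<tau> k = 1 / (qpow \<tau> (- (of_int k / 2)) - qpow \<tau> (of_int k / 2))"

lemma lambert_coeff_0 [simp]: "lambert_coeff \<tau> 0 = 0"
  by (simp add: lambert_coeff_def)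

lemma lambert_coeff_minus: "lambert_coeff \<tau> (- k) = - lambert_coeff \<tau> k"
  unfolding lambert_coeff_def by (subst minus_divide_right) simp

text \<open>With \<open>a = pi * Im \<tau> * |k|\<close> the two powers have norms
  \<open>exp a\<close> and \<open>exp (- a)\<close> in some order, and the reverse triangle
  inequality applies. The bound \<open>|k| \<ge> 1\<close> makes the constant independent of
  \<open>k\<close>.\<close>

lemma norm_lambert_denominator:
  assumes "Im \<tau> > 0" "k \<noteq> 0"
  shows "exp (pi * Im \<tau> * \<bar>real_of_int k\<bar>) * (1 - exp (- (2 * pi * Im \<tau>))) \<le>
    norm (qpow \<tau> (- (of_int k / 2)) - qpow \<tau> (of_int k / 2))"
proof -
  define a where "a = pi * Im \<tau> * \<bar>real_of_int k\<bar>"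
  have "\<bar>real_of_int k\<bar> \<ge> 1" using assms(2) by linarith
  hence "pi * Im \<tau> * 1 \<le> a" unfolding a_def using assms by (intro mult_left_mono) auto
  hence "exp a * (1 - exp (- (2 * pi * Im \<tau>))) \<le> exp a * (1 - exp (- (2 * a)))" by simp
  also have "\<dots> = exp a - exp (- a)"
    by (simp add: right_diff_distrib exp_add [symmetric])
  also have "\<dots> \<le> \<bar>norm (qpow \<tau> (- (of_int k / 2))) - norm (qpow \<tau> (of_int k / 2))\<bar>"
    by (cases "k > 0") (auto simp: norm_qpow a_def mult_ac)
  also have "\<dots> \<le> norm (qpow \<tau> (- (of_int k / 2)) - qpow \<tau> (of_int k / 2))"
    by (rule norm_triangle_ineq3)
  finally show ?thesis unfolding a_def .
qed

lemma lambert_denominator_nonzero: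
  assumes "Im \<tau> > 0" "k \<noteq> 0"
  shows "qpow \<tau> (- (of_int k / 2)) - qpow \<tau> (of_int k / 2) \<noteq> 0"
proof -
  have "exp (pi * Im \<tau> * \<bar>real_of_int k\<bar>) * (1 - exp (- (2 * pi * Im \<tau>))) > 0"
    using assms(1) by simp
  with norm_lambert_denominator[OF assms] show ?thesis by (auto simp del: right_minus_eq)
qed

lemma norm_lambert_coeff:
  assumes "Im \<tau> > 0"
  shows "norm (lambert_coeff \<tau> k) \<le>
    1 / (1 - exp (- (2 * pi * Im \<tau>))) * exp (- (pi * Im \<tau>) * \<bar>real_of_int k\<bar>)"
proof (cases "k = 0")
  case False
  have pos: "exp (pi * Im \<tau> * \<bar>real_of_int k\<bar>) * (1 - exp (- (2 * pi * Im \<tau>))) > 0"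
    using assms by simp
  have "norm (lambert_coeff \<tau> k) \<le> 1 / (exp (pi * Im \<tau> * \<bar>real_of_int k\<bar>) * (1 - exp (- (2 * pi * Im \<tau>))))"
    unfolding lambert_coeff_def norm_divide norm_one
    using norm_lambert_denominator[OF assms False] pos
    by (intro divide_left_mono mult_pos_pos less_le_trans[OF pos]) auto
  thus ?thesis by (simp add: exp_minus field_simps)
qed (use assms in simp)

text \<open>The Lambert coefficients are bounded and the cross term \<open>n * k\<close> costs only
  exponential growth in \<open>k\<close>, so the Gaussian factor prevails for each fixed
  \<open>n\<close>.\<close>

lemma gauss_decay_lambert:
  assumes "Im \<tau> > 0"
  shows "gauss_decay (\<lambda>k. (- 1) powi k * qpow \<tau> ((of_int k)\<^sup>2 / 2 - of_int n * of_int k) * lambert_coeff \<tau> k)"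
proof -
  let ?C = "1 / (1 - exp (- (2 * pi * Im \<tau>)))"
  have "gauss_decay (\<lambda>k. (qpow \<tau> (- (of_int n * of_int k)) * lambert_coeff \<tau> k)
          * ((- 1) powi k * qpow \<tau> ((of_int k)\<^sup>2 / 2)))"
  proof (rule gauss_decay_mult[OF gauss_decay_alternating[OF assms]])
    fix k :: int
    let ?K = "2 * pi * Im \<tau> * \<bar>of_int n\<bar>"
    have "norm (lambert_coeff \<tau> k) \<le> ?C * 1"
      by (rule order.trans[OF norm_lambert_coeff[OF assms]], rule mult_left_mono) (use assms in auto)
    moreover have "norm (qpow \<tau> (- (of_int n * of_int k))) \<le> exp (?K * \<bar>of_int k\<bar>)"
    proof -
      have "of_int n * of_int k \<le> \<bar>of_int n\<bar> * \<bar>real_of_int k\<bar>"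
        by (metis abs_ge_self abs_mult)
      hence "(2 * pi * Im \<tau>) * (of_int n * of_int k) \<le> (2 * pi * Im \<tau>) * (\<bar>of_int n\<bar> * \<bar>real_of_int k\<bar>)"
        using assms by (intro mult_left_mono) auto
      thus ?thesis by (simp add: norm_qpow mult_ac)
    qed
    ultimately have "norm (qpow \<tau> (- (of_int n * of_int k))) * norm (lambert_coeff \<tau> k) \<le> exp (?K * \<bar>of_int k\<bar>) * (?C * 1)"
      by (intro mult_mono) auto
    thus "norm (qpow \<tau> (- (of_int n * of_int k)) * lambert_coeff \<tau> k) \<le> ?C * exp (?K * \<bar>of_int k\<bar>)"
      by (simp add: norm_mult mult_ac)
  qed
  moreover have "qpow \<tau> ((of_int k)\<^sup>2 / 2 - of_int n * of_int k) =
      qpow \<tau> (- (of_int n * of_int k)) * qpow \<tau> ((of_int k)\<^sup>2 / 2)" for k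
    by (subst qpow_add [symmetric]) (simp add: algebra_simps)
  ultimately show ?thesis by (simp add: mult_ac)
qed

text \<open>The reflection \<open>k \<mapsto> 2 n + 1 - k\<close> preserves the exponent and changes the sign.\<close>

lemma alternating_qpow_has_sum_0:
  assumes "Im \<tau> > 0"
  shows "((\<lambda>k. (- 1) powi k * qpow \<tau> (of_int k * (of_int k - (2 * of_int n + 1)) / 2)) has_sum 0) UNIV"
proof -
  let ?w = "\<lambda>k. (- 1) powi k * qpow \<tau> (of_int k * (of_int k - (2 * of_int n + 1)) / 2)"
  have "gauss_decay (\<lambda>k. qpow \<tau> (- (of_int k * (2 * of_int n + 1) / 2)) * ((- 1) powi k * qpow \<tau> ((of_int k)\<^sup>2 / 2)))"
  proof (rule gauss_decay_mult[OF gauss_decay_alternating[OF assms]])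
    fix k :: int
    have "of_int k * (2 * of_int n + 1) \<le> \<bar>real_of_int k\<bar> * \<bar>2 * of_int n + 1\<bar>"
      by (metis abs_ge_self abs_mult)
    hence "(pi * Im \<tau>) * (of_int k * (2 * of_int n + 1)) \<le> (pi * Im \<tau>) * (\<bar>of_int k\<bar> * \<bar>2 * of_int n + 1\<bar>)"
      using assms by (intro mult_left_mono) auto
    moreover have "- 2 * pi * (- (of_int k * (2 * of_int n + 1) / 2)) * Im \<tau> = (pi * Im \<tau>) * (of_int k * (2 * of_int n + 1))"
      by simp
    ultimately show "norm (qpow \<tau> (- (of_int k * (2 * of_int n + 1) / 2))) \<le> 1 * exp (pi * Im \<tau> * \<bar>2 * of_int n + 1\<bar> * \<bar>of_int k\<bar>)"
      unfolding norm_qpow by (simp only: exp_le_cancel_iff mult_1) (simp only: mult_ac)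
  qed
  moreover have "qpow \<tau> (of_int k * (of_int k - (2 * of_int n + 1)) / 2) =
      qpow \<tau> (- (of_int k * (2 * of_int n + 1) / 2)) * qpow \<tau> ((of_int k)\<^sup>2 / 2)" for k
    unfolding qpow_add [symmetric]
    by (rule arg_cong[where f = "qpow \<tau>"]) (simp add: power2_eq_square field_simps)
  ultimately have "gauss_decay ?w" by (simp add: mult_ac)
  from has_sum_infsum[OF abs_summable_summable[OF gauss_decay_abs_summable[OF this]]]
  have w: "(?w has_sum infsum ?w UNIV) UNIV" .
  have "infsum ?w UNIV = infsum (\<lambda>k. - ?w k) UNIV"
  proof (rule infsum_reindex_bij_witness[of _ "\<lambda>k. 2 * n + 1 - k" "\<lambda>k. 2 * n + 1 - k"])
    fix k :: int
    have "of_int (2 * n + 1 - k) * (of_int (2 * n + 1 - k) - (2 * of_int n + 1)) = real_of_int k * (of_int k - (2 * of_int n + 1))"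
      by (simp add: algebra_simps)
    thus "- ?w (2 * n + 1 - k) = ?w k"
      by (simp only:) (simp add: power_int_minus_left)
  qed auto
  hence "infsum ?w UNIV = 0" by (simp add: infsum_uminus)
  with w show ?thesis by simp
qed

text \<open>Raising \<open>n\<close> by one produces the numerator \<open>p^(-k) - p^k\<close> with
  \<open>p = qpow \<tau> (1 / 2)\<close>, which cancels the denominator. At \<open>k = 0\<close> the
  left side is 0 by convention while the alternating term is 1, hence the correction.\<close>

lemma lambert_partial_fraction_step:
  assumes "Im \<tau> > 0"
  shows "(- 1) powi k * qpow \<tau> ((of_int k)\<^sup>2 / 2 - of_int (n + 1) * of_int k) * lambert_coeff \<tau> k
      - (- 1) powi k * qpow \<tau> ((of_int k)\<^sup>2 / 2 - of_int n * of_int k) * lambert_coeff \<tau> k =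
    (- 1) powi k * qpow \<tau> (of_int k * (of_int k - (2 * of_int n + 1)) / 2) - (if k = 0 then 1 else 0)"
proof (cases "k = 0")
  case False
  let ?d = "qpow \<tau> (- (of_int k / 2)) - qpow \<tau> (of_int k / 2)"
  let ?e = "of_int k * (of_int k - (2 * of_int n + 1)) / 2"
  have "qpow \<tau> ((of_int k)\<^sup>2 / 2 - of_int (n + 1) * of_int k) = qpow \<tau> ?e * qpow \<tau> (- (of_int k / 2))"
    unfolding qpow_add [symmetric]
    by (rule arg_cong[where f = "qpow \<tau>"]) (simp add: power2_eq_square field_simps)
  moreover have "qpow \<tau> ((of_int k)\<^sup>2 / 2 - of_int n * of_int k) = qpow \<tau> ?e * qpow \<tau> (of_int k / 2)"
    unfolding qpow_add [symmetric]
    by (rule arg_cong[where f = "qpow \<tau>"]) (simp add: power2_eq_square field_simps)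
  ultimately have "(- 1) powi k * qpow \<tau> ((of_int k)\<^sup>2 / 2 - of_int (n + 1) * of_int k) * lambert_coeff \<tau> k
      - (- 1) powi k * qpow \<tau> ((of_int k)\<^sup>2 / 2 - of_int n * of_int k) * lambert_coeff \<tau> k =
     (- 1) powi k * qpow \<tau> ?e * (?d * lambert_coeff \<tau> k)"
    by (simp only:) (simp add: algebra_simps)
  moreover have "?d * lambert_coeff \<tau> k = 1"
    using lambert_denominator_nonzero[OF assms False] by (simp add: lambert_coeff_def)
  ultimately show ?thesis using False by simp
qed simp

text \<open>At \<open>n = 0\<close> the terms are odd in \<open>k\<close>, so the sum is 0. Each
  step \<open>n\<close> to \<open>n + 1\<close> lowers it by 1: the alternating series contributes 0
  and the correction at \<open>k = 0\<close> contributes \<open>- 1\<close>. Induction runs in both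
  directions.\<close>

lemma lambert_convolution:
  assumes "Im \<tau> > 0"
  shows "((\<lambda>k. (- 1) powi k * qpow \<tau> ((of_int k)\<^sup>2 / 2 - of_int n * of_int k) * lambert_coeff \<tau> k)
           has_sum (- of_int n)) UNIV"
proof -
  define g where "g = (\<lambda>n k. (- 1) powi k * qpow \<tau> ((of_int k)\<^sup>2 / 2 - of_int n * of_int k) * lambert_coeff \<tau> k)"
  define S where "S = (\<lambda>n. infsum (g n) UNIV)"
  have S: "(g n has_sum S n) UNIV" for n
    unfolding S_def g_def
    by (rule has_sum_infsum[OF abs_summable_summable[OF gauss_decay_abs_summable[OF gauss_decay_lambert[OF assms]]]])
  have "infsum (g 0) UNIV = infsum (\<lambda>k. - g 0 k) UNIV"
    by (rule infsum_reindex_bij_witness[of _ uminus uminus])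
       (auto simp: g_def lambert_coeff_minus power_int_minus_left power_int_minus)
  hence S0: "S 0 = 0" by (simp add: S_def infsum_uminus)
  have step: "S (n + 1) = S n - 1" for n
  proof -
    have "((\<lambda>k :: int. if k = 0 then 1 else 0 :: complex) has_sum 1) UNIV"
      by (rule has_sum_cong_neutral[THEN iffD1, OF _ _ _ has_sum_finite[of "{0}" "\<lambda>_. 1"], simplified]) auto
    from has_sum_diff[OF alternating_qpow_has_sum_0[OF assms] this, of n]
    have "((\<lambda>k. g (n + 1) k - g n k) has_sum (0 - 1)) UNIV"
      unfolding g_def lambert_partial_fraction_step[OF assms] .
    from has_sum_unique[OF has_sum_diff[OF S S] this] show ?thesis by (simp add: algebra_simps)
  qed
  have "S n = - of_int n"
  proof (induction n rule: int_induct[where k = 0])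
    case (step2 i) thus ?case using step[of "i - 1"] by (simp add: algebra_simps)
  qed (simp_all add: S0 step)
  with S[of n] show ?thesis unfolding g_def by simp
qed

section \<open>The Lambert series of the logarithmic derivative in the strip\<close>

lemma lambert_abs_summable:
  assumes "Im \<tau> > 0" "2 * \<bar>Im z\<bar> < pi * Im \<tau>"
  shows "(\<lambda>k. lambert_coeff \<tau> k * exp (\<i> * of_int k * (2 * z))) abs_summable_on UNIV"
proof -
  \<comment> \<open>This ratio weighs the growth of the exponential against the decay of
    \<open>lambert_coeff\<close>; the strip condition says \<open>\<rho> < 1\<close>.\<close>
  define \<rho> where "\<rho> = exp (2 * \<bar>Im z\<bar> - pi * Im \<tau>)"
  define C where "C = 1 / (1 - exp (- (2 * pi * Im \<tau>)))"
  have b: "norm (lambert_coeff \<tau> k * exp (\<i> * of_int k * (2 * z))) \<le> C * \<rho> powr \<bar>of_int k\<bar>" for k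
  proof -
    have "norm (lambert_coeff \<tau> k) * norm (exp (\<i> * of_int k * (2 * z))) \<le>
       (C * exp (- (pi * Im \<tau>) * \<bar>real_of_int k\<bar>)) * (1 * exp (\<bar>Im (2 * z)\<bar> * \<bar>real_of_int k\<bar>))"
      unfolding C_def by (rule mult_mono'[OF norm_lambert_coeff[OF assms(1)] norm_exp_int_le]) auto
    also have "\<dots> = C * \<rho> powr \<bar>of_int k\<bar>"
      by (simp add: \<rho>_def powr_def exp_add [symmetric] abs_mult algebra_simps)
    finally show ?thesis by (simp add: norm_mult)
  qed
  have s: "summable (\<lambda>n. C * \<rho> ^ n)"
    using assms by (intro summable_mult summable_geometric) (auto simp: \<rho>_def)
  have \<rho>: "\<rho> > 0" by (simp add: \<rho>_def)
  show ?thesis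
  proof (rule abs_summable_on_int)
    show "summable (\<lambda>n. norm (lambert_coeff \<tau> (int n) * exp (\<i> * of_int (int n) * (2 * z))))"
      by (rule summable_comparison_test'[OF s, of 0]) (use b[of "int _"] \<rho> in \<open>simp add: powr_realpow\<close>)
    have "norm (norm (lambert_coeff \<tau> (- int (Suc n)) * exp (\<i> * of_int (- int (Suc n)) * (2 * z)))) \<le> C * \<rho> ^ Suc n" for n
    proof -
      have "\<bar>real_of_int (- int (Suc n))\<bar> = real (Suc n)" by simp
      with b[of "- int (Suc n)"] \<rho> show ?thesis by (simp only: powr_realpow) simp
    qed
    thus "summable (\<lambda>n. norm (lambert_coeff \<tau> (- int (Suc n)) * exp (\<i> * of_int (- int (Suc n)) * (2 * z))))"
      by (rule summable_comparison_test'[OF summable_Suc_iff[THEN iffD2, OF s]])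
  qed
qed

lemma deriv_theta4_eq_lambert:
  assumes tau: "Im \<tau> > 0" and z: "2 * \<bar>Im z\<bar> < pi * Im \<tau>"
  shows "deriv (\<lambda>w. theta4 w \<tau>) z =
    - 2 * \<i> * theta4 z \<tau> * (\<Sum>\<^sub>\<infinity>k. lambert_coeff \<tau> k * exp (\<i> * of_int k * (2 * z)))"
proof -
  define c where "c = (\<lambda>a. (- 1) powi a * qpow \<tau> ((real_of_int a)\<^sup>2 / 2))"
  define L where "L = (\<Sum>\<^sub>\<infinity>k. lambert_coeff \<tau> k * exp (\<i> * of_int k * (2 * z)))"
  have c: "gauss_decay c" unfolding c_def by (rule gauss_decay_alternating[OF tau])
  have th: "theta4 w \<tau> = fourier c (2 * w)" for w
    unfolding theta4_eq_fourier[OF tau] fourier_coeff4_halved c_def ..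
  have "((\<lambda>(a, k). (c a * exp (\<i> * of_int a * (2 * z))) * (lambert_coeff \<tau> k * exp (\<i> * of_int k * (2 * z))))
          has_sum theta4 z \<tau> * L) (UNIV \<times> UNIV)"
    unfolding th fourier_def L_def
    by (intro has_sum_times gauss_decay_abs_summable gauss_decay_exp c lambert_abs_summable tau z)
  hence "((\<lambda>(n, k). c (n - k) * lambert_coeff \<tau> k * exp (\<i> * of_int n * (2 * z)))
          has_sum theta4 z \<tau> * L) (UNIV \<times> UNIV)"
    by (rule has_sum_reindex_bij_witness[of _ "\<lambda>(n, k). (n - k, k)" "\<lambda>(a, k). (a + k, k)", THEN iffD1, rotated -1])
       (auto simp: exp_add [symmetric] algebra_simps)
  \<comment> \<open>In the double series indexed by the total frequency \<open>n = a + k\<close>,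
    the sum over \<open>k\<close> is taken first. Since
    \<open>(n - k)^2 = n^2 + k^2 - 2 * n * k\<close>, the factor \<open>c n\<close> comes out and
    \<open>lambert_convolution\<close> supplies \<open>- n\<close>.\<close>
  hence "((\<lambda>n. - of_int n * c n * exp (\<i> * of_int n * (2 * z))) has_sum theta4 z \<tau> * L) UNIV"
  proof (rule has_sum_SigmaD)
    fix n :: int
    have "c (n - k) = c n * ((- 1) powi k * qpow \<tau> ((of_int k)\<^sup>2 / 2 - of_int n * of_int k))" for k
    proof -
      have "qpow \<tau> ((real_of_int (n - k))\<^sup>2 / 2) = qpow \<tau> ((of_int n)\<^sup>2 / 2) * qpow \<tau> ((of_int k)\<^sup>2 / 2 - of_int n * of_int k)"
        unfolding qpow_add [symmetric]
    by (rule arg_cong[where f = "qpow \<tau>"]) (simp add: power2_eq_square field_simps)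
      moreover have "(- 1 :: complex) powi (n - k) = (- 1) powi n * (- 1) powi k"
        by (simp add: power_int_minus_left)
      ultimately show ?thesis unfolding c_def by (simp only: mult_ac)
    qed
    hence eq: "(\<lambda>k. case (n, k) of (n, k) \<Rightarrow> c (n - k) * lambert_coeff \<tau> k * exp (\<i> * of_int n * (2 * z))) =
      (\<lambda>k. (c n * exp (\<i> * of_int n * (2 * z))) *
      ((- 1) powi k * qpow \<tau> ((of_int k)\<^sup>2 / 2 - of_int n * of_int k) * lambert_coeff \<tau> k))"
      by (simp only: prod.case mult_ac)
    show "((\<lambda>k. case (n, k) of (n, k) \<Rightarrow> c (n - k) * lambert_coeff \<tau> k * exp (\<i> * of_int n * (2 * z)))
       has_sum - of_int n * c n * exp (\<i> * of_int n * (2 * z))) UNIV"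
      unfolding eq
      using has_sum_cmult_right[OF lambert_convolution[OF tau], of "c n * exp (\<i> * of_int n * (2 * z))" n]
      by (simp only: mult_ac mult_minus_left mult_minus_right)
  qed
  from has_sum_cmult_right[OF this, of "- \<i>"]
  have "fourier (\<lambda>n. \<i> * of_int n * c n) (2 * z) = - \<i> * (theta4 z \<tau> * L)"
    unfolding fourier_def by (intro infsumI) (simp add: mult_ac)
  moreover have "((\<lambda>w. theta4 w \<tau>) has_field_derivative fourier (\<lambda>n. \<i> * of_int n * c n) (2 * z) * 2) (at z)"
    unfolding th
    by (rule DERIV_chain2[OF fourier_has_field_derivative[OF c]]) (auto intro!: derivative_eq_intros)
  ultimately show ?thesis unfolding L_def by (simp add: DERIV_imp_deriv)
qed

text \<open>As \<open>lambert_coeff\<close> is odd, opposite indices combine to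
  \<open>2 * \<i>\<close> times a sine, and the prefactor \<open>- 2 * \<i>\<close> turns this into
  4. Expanding by \<open>p^m\<close> rewrites \<open>1 / (p^(-m) - p^m)\<close> as
  \<open>p^m / (1 - p^(2 * m))\<close>.\<close>

lemma log_theta4'_sums:
  assumes tau: "Im \<tau> > 0" and z: "2 * \<bar>Im z\<bar> < pi * Im \<tau>" and nz: "theta4 z \<tau> \<noteq> 0"
  shows "(\<lambda>n. 4 * (qpow \<tau> (real (Suc n) / 2) / (1 - qpow \<tau> (real (Suc n))) * sin (2 * of_nat (Suc n) * z)))
     sums log_theta4' z \<tau>"
proof -
  let ?f = "\<lambda>k. lambert_coeff \<tau> k * exp (\<i> * of_int k * (2 * z))"
  have "log_theta4' z \<tau> = - 2 * \<i> * infsum ?f UNIV"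
    unfolding log_theta4'_def deriv_theta4_eq_lambert[OF tau z] using nz by simp
  moreover have "(\<lambda>n. - 2 * \<i> * (?f (int (Suc n)) + ?f (- int (Suc n)))) sums (- 2 * \<i> * (infsum ?f UNIV - ?f 0))"
    by (intro sums_mult sums_int_symmetric lambert_abs_summable tau z)
  moreover have "- 2 * \<i> * (?f (int m) + ?f (- int m)) =
     4 * (qpow \<tau> (real m / 2) / (1 - qpow \<tau> (real m)) * sin (2 * of_nat m * z))" for m
  proof -
    have "qpow \<tau> (real m) = qpow \<tau> (real m / 2) * qpow \<tau> (real m / 2)"
      by (subst qpow_add [symmetric]) simp
    moreover have "qpow \<tau> (- (real m / 2)) = 1 / qpow \<tau> (real m / 2)"
      using qpow_add[of \<tau> "- (real m / 2)" "real m / 2"] by (simp add: field_simps)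
    ultimately have "lambert_coeff \<tau> (int m) = qpow \<tau> (real m / 2) / (1 - qpow \<tau> (real m))"
      unfolding lambert_coeff_def of_int_of_nat_eq
      by (simp only: diff_divide_distrib divide_divide_eq_left) (simp add: divide_simps)
    hence "- 2 * \<i> * (?f (int m) + ?f (- int m)) = qpow \<tau> (real m / 2) / (1 - qpow \<tau> (real m)) *
        (- 2 * \<i> * (exp (\<i> * (2 * of_nat m * z)) - exp (- \<i> * (2 * of_nat m * z))))"
      unfolding lambert_coeff_minus by (simp add: algebra_simps)
    also have "- 2 * \<i> * (exp (\<i> * (2 * of_nat m * z)) - exp (- \<i> * (2 * of_nat m * z))) = 4 * sin (2 * of_nat m * z)"
      unfolding sin_exp_eq by (simp add: field_simps)
    finally show ?thesis by (simp add: mult_ac)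
  qed
  ultimately show ?thesis by (simp only: lambert_coeff_0) simp
qed

section \<open>Convergence of the Lambert series and the theorem\<close>

text \<open>Passing from \<open>a\<^sub>n\<close> to \<open>a\<^bsub>n+1\<^esub> - w a\<^sub>n\<close> eliminates the base \<open>w\<close>.\<close>

lemma exponential_sum_tendsto_0:
  fixes c :: "complex \<Rightarrow> complex"
  assumes "finite A" "(\<lambda>n. \<Sum>z\<in>A. c z * z ^ n) \<longlonglongrightarrow> 0" "z \<in> A" "c z \<noteq> 0"
  shows "norm z < 1"
  using assms
proof (induction A arbitrary: c z rule: finite_induct)
  case (insert w A)
  let ?a = "\<lambda>n. \<Sum>z\<in>insert w A. c z * z ^ n"
  have "(\<lambda>n. ?a (Suc n) - w * ?a n) \<longlonglongrightarrow> 0 - w * 0"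
    by (intro tendsto_intros LIMSEQ_Suc insert.prems)
  also have "(\<lambda>n. ?a (Suc n) - w * ?a n) = (\<lambda>n. \<Sum>z\<in>A. (c z * (z - w)) * z ^ n)"
    using insert.hyps by (simp add: sum_distrib_left sum_subtractf [symmetric] algebra_simps)
  finally have lim: "(\<lambda>n. \<Sum>z\<in>A. (c z * (z - w)) * z ^ n) \<longlonglongrightarrow> 0" by simp
  have A: "norm x < 1" if "x \<in> A" "c x \<noteq> 0" for x
    using insert.IH[OF lim, of x] that insert.hyps by auto
  show ?case
  proof (cases "z = w")
    case True
    \<comment> \<open>The induction hypothesis covers only the bases in \<open>A\<close>. Their
      contribution tends to 0, which isolates the term of \<open>w\<close>.\<close>
    have "(\<lambda>n. \<Sum>x\<in>A. c x * x ^ n) \<longlonglongrightarrow> (\<Sum>x\<in>A. 0)"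
    proof (rule tendsto_sum)
      fix x assume "x \<in> A"
      show "(\<lambda>n. c x * x ^ n) \<longlonglongrightarrow> 0"
        using A[OF \<open>x \<in> A\<close>] by (cases "c x = 0") (auto intro!: tendsto_mult_right_zero LIMSEQ_power_zero)
    qed
    from tendsto_diff[OF insert.prems(1) this] have "(\<lambda>n. c w * w ^ n) \<longlonglongrightarrow> 0"
      using insert.hyps by simp
    from tendsto_mult_left[OF this, of "inverse (c w)"] have "(\<lambda>n. w ^ n) \<longlonglongrightarrow> 0"
      using insert.prems True by (simp flip: mult.assoc)
    hence "eventually (\<lambda>n. norm (w ^ n) < 1) sequentially"
      by (intro order_tendstoD(2)[where y = 0]) (auto intro: tendsto_norm_zero)
    then obtain n where "norm w ^ n < 1"
      by (auto simp: norm_power eventually_sequentially)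
    thus ?thesis unfolding True using one_le_power[of "norm w" n] by linarith
  next
    case False
    with insert.prems have "z \<in> A" "c z \<noteq> 0" by simp_all
    thus ?thesis by (rule A)
  qed
qed simp

text \<open>A positive base \<open>p * x i\<close> can cancel only against some
  \<open>p / x j\<close> with \<open>x i * x j = 1\<close>. When this is excluded, the total
  coefficients of \<open>p * x i\<close> and \<open>p / x i\<close> are nonzero.\<close>

lemma exponential_differences_tendsto_0:
  fixes x :: "'a \<Rightarrow> complex"
  assumes I: "finite I" and nz: "p \<noteq> 0" "\<And>i. i \<in> I \<Longrightarrow> x i \<noteq> 0" and p: "norm p < 1"
    and lim: "(\<lambda>n. \<Sum>i\<in>I. (p * x i) ^ n - (p / x i) ^ n) \<longlonglongrightarrow> 0"
    and pairs: "\<And>i j. i \<in> I \<Longrightarrow> j \<in> I \<Longrightarrow> i \<noteq> j \<Longrightarrow> x i * x j \<noteq> 1"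
    and i: "i \<in> I"
  shows "norm (p * x i) < 1 \<and> norm (p / x i) < 1"
\<comment> \<open>In this case the two powers for \<open>i\<close> cancel and the limit gives no
  information, but \<open>x i\<close> has norm 1 and \<open>norm p < 1\<close> suffices.\<close>
proof (cases "x i * x i = 1")
  case True
  hence "norm (x i) = 1"
    by (metis norm_mult norm_one abs_norm_cancel abs_square_eq_1 power2_eq_square)
  thus ?thesis using p by (simp add: norm_mult norm_divide)
next
  case False
  define A where "A = (\<lambda>i. p * x i) ` I \<union> (\<lambda>i. p / x i) ` I"
  \<comment> \<open>The bases need not be distinct, so equal ones are collected with signed
    multiplicity.\<close>
  define c :: "complex \<Rightarrow> complex" where
    "c z = of_nat (card {j \<in> I. p * x j = z}) - of_nat (card {j \<in> I. p / x j = z})" for z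
  have A: "finite A" using I by (simp add: A_def)
  have count: "(\<Sum>j\<in>I. f j ^ n) = (\<Sum>z\<in>A. of_nat (card {j \<in> I. f j = z}) * z ^ n)"
    if "f ` I \<subseteq> A" for f :: "'a \<Rightarrow> complex" and n
  proof -
    have "(\<Sum>j\<in>I. f j ^ n) = (\<Sum>z\<in>A. \<Sum>j | j \<in> I \<and> f j = z. f j ^ n)"
      by (rule sum.group [symmetric]) (use I A that in auto)
    also have "\<dots> = (\<Sum>z\<in>A. \<Sum>j | j \<in> I \<and> f j = z. z ^ n)"
      by (intro sum.cong refl) auto
    finally show ?thesis by simp
  qed
  have "(\<lambda>n. \<Sum>z\<in>A. c z * z ^ n) = (\<lambda>n. \<Sum>i\<in>I. (p * x i) ^ n - (p / x i) ^ n)"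
    unfolding c_def left_diff_distrib sum_subtractf
    by (subst (1 2) count) (auto simp: A_def)
  with lim have lim': "(\<lambda>n. \<Sum>z\<in>A. c z * z ^ n) \<longlonglongrightarrow> 0" by simp
  have ne: "x i * x j \<noteq> 1" if "j \<in> I" for j
    using pairs[OF i that] False by blast
  have "{j \<in> I. p / x j = p * x i} = {}" "{j \<in> I. p * x j = p / x i} = {}"
    using ne nz i by (auto simp: field_simps)
  moreover have "card {j \<in> I. p * x j = p * x i} \<noteq> 0" "card {j \<in> I. p / x j = p / x i} \<noteq> 0"
    using I i by auto
  ultimately have "c (p * x i) \<noteq> 0" "c (p / x i) \<noteq> 0"
    unfolding c_def by (simp_all only: card.empty) simp_all
  moreover have "p * x i \<in> A" "p / x i \<in> A" using i by (auto simp: A_def)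
  ultimately show ?thesis
    using exponential_sum_tendsto_0[OF A lim'] by blast
qed

section \<open>Cancelling pairs and the reduction to exponential sums\<close>

lemma exp_2i_eq_1_iff: "exp (2 * \<i> * z) = 1 \<longleftrightarrow> (\<exists>m :: int. z = of_int m * of_real pi)"
proof -
  have "exp (2 * \<i> * z) = 1 \<longleftrightarrow> Im z = 0 \<and> (\<exists>m :: int. Re z = of_int m * pi)"
    by (simp add: exp_eq_1)
  thus ?thesis by (auto simp: complex_eq_iff)
qed

lemma sin_add_sin_eq_0:
  assumes "a + b = of_int m * of_real pi"
  shows "sin (2 * of_nat n * a) + sin (2 * of_nat n * b) = (0 :: complex)"
proof -
  have b: "b = of_int m * of_real pi - a" using assms by (simp add: algebra_simps)
  have "exp (\<i> * (2 * of_nat n * b)) = exp (\<i> * of_int (2 * int n) * (of_int m * of_real pi)) * exp (- (\<i> * (2 * of_nat n * a)))"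
    and "exp (- (\<i> * (2 * of_nat n * b))) = exp (\<i> * of_int (- 2 * int n) * (of_int m * of_real pi)) * exp (\<i> * (2 * of_nat n * a))"
    unfolding exp_add [symmetric] b by (simp_all add: algebra_simps)
  thus ?thesis unfolding exp_int_pi sin_exp_eq by (simp add: power_int_minus_left field_simps)
qed

lemma theta1_int_pi:
  assumes "Im \<tau> > 0"
  shows "theta1 (of_int m * of_real pi) \<tau> = 0"
proof -
  have "theta1 0 \<tau> = 0" by (simp add: theta1_def)
  with theta1_add_int_pi[OF assms, of 0 m] show ?thesis by simp
qed

text \<open>Multiplying by \<open>1 - q^n\<close> leaves a pure combination of \<open>n\<close>-th
  powers. Indexing by list position keeps multiplicities when some of the points coincide.\<close>

lemma lambert_term_eq:
  assumes "Im \<tau> > 0" "n > 0"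
  shows "2 * \<i> * (1 - qpow \<tau> (real n)) * lambert_term \<tau> s t u v n =
    (\<Sum>i<4. (qpow \<tau> (1 / 2) * exp (2 * \<i> * ([s, t, u, v] ! i))) ^ n
           - (qpow \<tau> (1 / 2) / exp (2 * \<i> * ([s, t, u, v] ! i))) ^ n)"
proof -
  have "norm (qpow \<tau> (real n)) < 1" using assms by (simp add: norm_qpow)
  hence "1 - qpow \<tau> (real n) \<noteq> 0" by auto
  hence "2 * \<i> * (1 - qpow \<tau> (real n)) * lambert_term \<tau> s t u v n = qpow \<tau> (real n / 2) *
    (2 * \<i> * sin (2 * of_nat n * s) + 2 * \<i> * sin (2 * of_nat n * t) + 2 * \<i> * sin (2 * of_nat n * u) + 2 * \<i> * sin (2 * of_nat n * v))"
    unfolding lambert_term_def by (simp add: field_simps)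
  moreover have "2 * \<i> * sin (2 * of_nat n * z) = exp (2 * \<i> * z) ^ n - 1 / exp (2 * \<i> * z) ^ n" for z
  proof -
    have e: "exp (2 * \<i> * z) ^ n = exp (\<i> * (2 * of_nat n * z))"
      by (subst exp_of_nat_mult [symmetric]) (simp add: mult_ac)
    show ?thesis unfolding e sin_exp_eq by (simp add: exp_minus inverse_eq_divide)
  qed
  moreover have "qpow \<tau> (real n / 2) = qpow \<tau> (1 / 2) ^ n"
    unfolding qpow_def by (subst exp_of_nat_mult [symmetric]) (simp add: mult_ac)
  ultimately show ?thesis
    by (simp only:) (simp add: eval_nat_numeral power_mult_distrib power_divide right_diff_distrib distrib_left)
qed

text \<open>Terms of a convergent series tend to 0, also after multiplication by the convergent
  factor \<open>2 * \<i> * (1 - q^n)\<close>. Without cancelling pairs all bases then have norm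
  below 1, and for a point \<open>z\<close> its two bases give the bounds on \<open>Im z\<close>
  from both sides.\<close>

lemma summable_lambert_imp_strip:
  assumes tau: "Im \<tau> > 0" and sm: "summable (\<lambda>n. lambert_term \<tau> s t u v (Suc n))"
    and pairs: "\<And>i j m. i < 4 \<Longrightarrow> j < 4 \<Longrightarrow> i \<noteq> j \<Longrightarrow>
      [s, t, u, v] ! i + [s, t, u, v] ! j \<noteq> of_int m * of_real pi"
    and z: "z \<in> {s, t, u, v}"
  shows "2 * \<bar>Im z\<bar> < pi * Im \<tau>"
proof -
  let ?p = "qpow \<tau> (1 / 2)"
  let ?x = "\<lambda>i. exp (2 * \<i> * ([s, t, u, v] ! i))"
  have q: "qpow \<tau> (real n) = qpow \<tau> 1 ^ n" for n
    unfolding qpow_def by (subst exp_of_nat_mult [symmetric]) (simp add: mult_ac)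
  have "(\<lambda>n. 2 * \<i> * (1 - qpow \<tau> 1 ^ Suc n) * lambert_term \<tau> s t u v (Suc n)) \<longlonglongrightarrow> 2 * \<i> * (1 - 0) * 0"
    using tau by (intro tendsto_intros LIMSEQ_Suc[OF LIMSEQ_power_zero] summable_LIMSEQ_zero[OF sm])
      (simp add: norm_qpow)
  hence "(\<lambda>n. \<Sum>i<4. (?p * ?x i) ^ Suc n - (?p / ?x i) ^ Suc n) \<longlonglongrightarrow> 0"
    unfolding q [symmetric] lambert_term_eq[OF tau zero_less_Suc] by simp
  hence lim: "(\<lambda>n. \<Sum>i<4. (?p * ?x i) ^ n - (?p / ?x i) ^ n) \<longlonglongrightarrow> 0"
    by (rule LIMSEQ_imp_Suc)
  obtain i where i: "i < 4" "z = [s, t, u, v] ! i"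
    using z by (fastforce simp: eval_nat_numeral)
  have "norm (?p * ?x i) < 1 \<and> norm (?p / ?x i) < 1"
  proof (rule exponential_differences_tendsto_0[OF _ _ _ _ lim])
    show "?x i * ?x j \<noteq> 1" if "i \<in> {..<4}" "j \<in> {..<4}" "i \<noteq> j" for i j
    proof -
      have "?x i * ?x j = exp (2 * \<i> * ([s, t, u, v] ! i + [s, t, u, v] ! j))"
        by (simp add: distrib_left exp_add)
      with pairs[of i j] that exp_2i_eq_1_iff[of "[s, t, u, v] ! i + [s, t, u, v] ! j"]
      show ?thesis by (metis lessThan_iff)
    qed
  qed (use tau i in \<open>auto simp: norm_qpow\<close>)
  moreover have "norm (?p * ?x i) = exp (- (pi * Im \<tau>) - 2 * Im z)" "norm (?p / ?x i) = exp (- (pi * Im \<tau>) + 2 * Im z)"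
    unfolding i(2) [symmetric] norm_mult norm_divide norm_qpow norm_exp_eq_Re exp_add [symmetric] exp_diff [symmetric]
    by simp_all
  ultimately show ?thesis by (simp add: abs_if)
qed

text \<open>The Lambert series can diverge at points where the first formula holds, so its
  evaluation assumes convergence, and the strip is given as a sufficient condition. The sign
  \<open>(- 1) powi k\<close> comes from the translation behaviour of \<open>theta1\<close>.\<close>

theorem theorem3p22:
  fixes \<tau> s t u v :: complex and k :: int
  assumes "Im \<tau> > 0"
    and "s + t + u + v = of_int k * of_real pi"
    and "theta4 s \<tau> * theta4 t \<tau> * theta4 u \<tau> * theta4 v \<tau> \<noteq> 0"
  shows "log_theta4' s \<tau> + log_theta4' t \<tau> + log_theta4' u \<tau> + log_theta4' v \<tau> =
      (- 1) powi k *
      (- (vartheta1' \<tau> * theta1 (s + t) \<tau> * theta1 (s + u) \<tau> * theta1 (s + v) \<tau>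
        / (theta4 s \<tau> * theta4 t \<tau> * theta4 u \<tau> * theta4 v \<tau>)))
    \<and> ((\<forall>z\<in>{s, t, u, v}. 2 * \<bar>Im z\<bar> < pi * Im \<tau>) \<longrightarrow>
      summable (\<lambda>n. lambert_term \<tau> s t u v (Suc n)))
    \<and> (summable (\<lambda>n. lambert_term \<tau> s t u v (Suc n)) \<longrightarrow>
      4 * (\<Sum>n. lambert_term \<tau> s t u v (Suc n)) =
      (- 1) powi k *
      (- (vartheta1' \<tau> * theta1 (s + t) \<tau> * theta1 (s + u) \<tau> * theta1 (s + v) \<tau>
        / (theta4 s \<tau> * theta4 t \<tau> * theta4 u \<tau> * theta4 v \<tau>))))"
    (is "?L = ?R \<and> (?strip \<longrightarrow> ?S) \<and> (?S \<longrightarrow> 4 * ?\<Sigma> = ?R)")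
proof (intro conjI impI)
  note tau = assms(1) and sum = assms(2)
  show main: "?L = ?R" by (rule sum_log_theta4'[OF assms])
  have sums: "(\<lambda>n. lambert_term \<tau> s t u v (Suc n)) sums (?L / 4)" if ?strip
  proof -
    have "(\<lambda>n. 4 * (qpow \<tau> (real (Suc n) / 2) / (1 - qpow \<tau> (real (Suc n))) * sin (2 * of_nat (Suc n) * z)))
        sums log_theta4' z \<tau>" if "z \<in> {s, t, u, v}" for z
      using that \<open>?strip\<close> assms(3) by (intro log_theta4'_sums tau) auto
    hence "(\<lambda>n. (4 * (qpow \<tau> (real (Suc n) / 2) / (1 - qpow \<tau> (real (Suc n))) * sin (2 * of_nat (Suc n) * s))
        + 4 * (qpow \<tau> (real (Suc n) / 2) / (1 - qpow \<tau> (real (Suc n))) * sin (2 * of_nat (Suc n) * t))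
        + 4 * (qpow \<tau> (real (Suc n) / 2) / (1 - qpow \<tau> (real (Suc n))) * sin (2 * of_nat (Suc n) * u))
        + 4 * (qpow \<tau> (real (Suc n) / 2) / (1 - qpow \<tau> (real (Suc n))) * sin (2 * of_nat (Suc n) * v))) / 4)
        sums (?L / 4)"
      by (intro sums_divide sums_add) simp_all
    moreover have "(4 * (c * a) + 4 * (c * b) + 4 * (c * d) + 4 * (c * e)) / 4 = c * (a + b + d + e)"
      for a b c d e :: complex
      by (simp add: field_simps)
    ultimately show ?thesis unfolding lambert_term_def by (simp only:)
  qed
  thus ?S if ?strip using that by (auto simp: sums_iff)
  \<comment> \<open>If two of the points sum to a multiple of pi, so do the remaining two. The three
    sums involving \<open>s\<close> therefore decide about all six pairs.\<close>
  have other: "b = of_int (k - m) * of_real pi" if "a = of_int m * of_real pi" "a + b = s + t + u + v" for a b m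
    using that sum by (metis add_diff_cancel_left' left_diff_distrib of_int_diff)
  assume S: ?S
  show "4 * ?\<Sigma> = ?R"
  \<comment> \<open>In the first case a \<open>theta1\<close> factor vanishes and the sines cancel
    in two pairs, whether or not the points lie in the strip. Otherwise convergence forces all four
    into it.\<close>
  proof (cases "\<exists>m :: int. s + t = of_int m * of_real pi \<or> s + u = of_int m * of_real pi \<or> s + v = of_int m * of_real pi")
    case True
    then obtain m :: int
      where m: "s + t = of_int m * of_real pi \<or> s + u = of_int m * of_real pi \<or> s + v = of_int m * of_real pi"
      by blast
    hence "?R = 0" using theta1_int_pi[OF tau, of m] by auto
    moreover have "lambert_term \<tau> s t u v n = 0" for n
    proof -
      let ?f = "\<lambda>z. sin (2 * of_nat n * z)"
      have cancel: "?f a + ?f b + (?f c + ?f d) = 0"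
        if "a + b = of_int m * of_real pi" "(a + b) + (c + d) = s + t + u + v" for a b c d
        using sin_add_sin_eq_0[OF that(1)] sin_add_sin_eq_0[OF other[OF that]] by simp
      from m have "?f s + ?f t + ?f u + ?f v = 0"
      proof (elim disjE)
        assume "s + t = of_int m * of_real pi"
        from cancel[OF this, of u v] show ?thesis by (simp add: algebra_simps)
      next
        assume "s + u = of_int m * of_real pi"
        from cancel[OF this, of t v] show ?thesis by (simp add: algebra_simps)
      next
        assume "s + v = of_int m * of_real pi"
        from cancel[OF this, of t u] show ?thesis by (simp add: algebra_simps)
      qed
      thus ?thesis unfolding lambert_term_def by simp
    qed
    ultimately show ?thesis by simp
  next
    case False
    have ne: "s + t \<noteq> of_int m * of_real pi" "s + u \<noteq> of_int m * of_real pi" "s + v \<noteq> of_int m * of_real pi" for m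
      using False by blast+
    have "u + v \<noteq> of_int m * of_real pi" "t + v \<noteq> of_int m * of_real pi" "t + u \<noteq> of_int m * of_real pi" for m
      using other[of "u + v" m "s + t"] other[of "t + v" m "s + u"] other[of "t + u" m "s + v"] ne[of "k - m"]
      by (auto simp: add_ac)
    with ne have "[s, t, u, v] ! i + [s, t, u, v] ! j \<noteq> of_int m * of_real pi" if "i < 4" "j < 4" "i \<noteq> j" for i j m
      using that by (auto simp: eval_nat_numeral less_Suc_eq add.commute)
    hence ?strip using summable_lambert_imp_strip[OF tau S] by blast
    with sums main show ?thesis by (simp add: sums_iff)
  qed
qed

end
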